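(* Let $k$ be a positive integer and let $p$ be a prime which is not a Wieferich prime greater than $3511$. Then $\bar f(-k-1)$ is not $p$-definable, where $f(n)=\sum_{j=0}^n\binom nj^{-1}$.
   Context: A Wieferich prime is a prime $p$ with $p^2\mid 2^{p-1}-1$. For $x=\sum_{i\ge0}\varepsilon_ip^i\in\mathbb{Z}_p$ with $\varepsilon_i\in\{0,\dots,p-1\}$, let $x_n=\sum_{i=0}^n\varepsilon_ip^i$. One says $\bar f(x)$ is $p$-definable if $\lim_{n\to\infty}f(x_n)$ exists in $\mathbb{Q}_p$, and then $\bar f(x)$ is this limit. Here $-k-1$ is regarded as an element of $\mathbb{Z}_p$. *)

theory Defs
  imports "HOL-Analysis.Analysis" "HOL-Computational_Algebra.Primes"
begin

definition wieferich_prime :: "nat \<Rightarrow> bool" where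
  "wieferich_prime p \<longleftrightarrow> prime p \<and> p ^ 2 dvd 2 ^ (p - 1) - 1"

section \<open>The \<open>p\<close>-adic absolute value on the rationals\<close>

definition padic_val :: "nat \<Rightarrow> rat \<Rightarrow> int" where
  "padic_val p x = int (multiplicity (int p) (fst (quotient_of x)))
                 - int (multiplicity (int p) (snd (quotient_of x)))"

definition padic_abs :: "nat \<Rightarrow> rat \<Rightarrow> real" where
  "padic_abs p x = (if x = 0 then 0 else real p powi (- padic_val p x))"

section \<open>The field of \<open>p\<close>-adic numbers as a complete metric space\<close>

text \<open>
  The \<open>p\<close>-adic numbers are the Cauchy sequences of rationals with respect to the \<open>p\<close>-adic
  absolute value, modulo null sequences. As \<open>p\<close> is a term, this is a set depending on \<open>p\<close> and not
  a type. Only the metric and the embedding of the rationals are needed here, so the field operations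
  are not defined.
\<close>

definition padic_Cauchy :: "nat \<Rightarrow> (nat \<Rightarrow> rat) set" where
  "padic_Cauchy p = {X. Metric_space.MCauchy UNIV (\<lambda>x y. padic_abs p (x - y)) X}"

definition padic_rel :: "nat \<Rightarrow> ((nat \<Rightarrow> rat) \<times> (nat \<Rightarrow> rat)) set" where
  "padic_rel p = {(X, Y). X \<in> padic_Cauchy p \<and> Y \<in> padic_Cauchy p \<and>
                          (\<lambda>n. padic_abs p (X n - Y n)) \<longlonglongrightarrow> 0}"

definition Qp :: "nat \<Rightarrow> (nat \<Rightarrow> rat) set set" where
  "Qp p = padic_Cauchy p // padic_rel p"

definition padic_of_rat :: "nat \<Rightarrow> rat \<Rightarrow> (nat \<Rightarrow> rat) set" where
  "padic_of_rat p q = padic_rel p `` {\<lambda>_. q}"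

definition padic_dist :: "nat \<Rightarrow> (nat \<Rightarrow> rat) set \<Rightarrow> (nat \<Rightarrow> rat) set \<Rightarrow> real" where
  "padic_dist p x y =
     (if x \<in> Qp p \<and> y \<in> Qp p
      then THE r. \<forall>X\<in>x. \<forall>Y\<in>y. (\<lambda>n. padic_abs p (X n - Y n)) \<longlonglongrightarrow> r
      else 0)"

definition Qp_topology :: "nat \<Rightarrow> (nat \<Rightarrow> rat) set topology" where
  "Qp_topology p = Metric_space.mtopology (Qp p) (padic_dist p)"

section \<open>Digit expansions and \<open>p\<close>-definability\<close>

definition padic_expansion :: "nat \<Rightarrow> (nat \<Rightarrow> rat) set \<Rightarrow> (nat \<Rightarrow> nat) \<Rightarrow> bool" where
  "padic_expansion p x \<epsilon> \<longleftrightarrow> (\<forall>i. \<epsilon> i < p) \<and>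
     limitin (Qp_topology p) (\<lambda>n. padic_of_rat p (of_nat (\<Sum>i\<le>n. \<epsilon> i * p ^ i))) x sequentially"

definition Zp :: "nat \<Rightarrow> (nat \<Rightarrow> rat) set set" where
  "Zp p = {x \<in> Qp p. \<exists>\<epsilon>. padic_expansion p x \<epsilon>}"

text \<open>
  The digits of \<open>x \<in> Zp p\<close> are unique by \<open>padic_expansion_unique\<close> when \<open>p\<close> is prime.
\<close>

definition padic_digits :: "nat \<Rightarrow> (nat \<Rightarrow> rat) set \<Rightarrow> nat \<Rightarrow> nat" where
  "padic_digits p x = (THE \<epsilon>. padic_expansion p x \<epsilon>)"

definition padic_trunc :: "nat \<Rightarrow> (nat \<Rightarrow> rat) set \<Rightarrow> nat \<Rightarrow> nat" where
  "padic_trunc p x n = (\<Sum>i\<le>n. padic_digits p x i * p ^ i)"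

text \<open>
  Meaningful only for \<open>x \<in> Zp p\<close>. The functions considered here take rational values; the limit is
  sought in \<open>Qp p\<close>.
\<close>

definition padic_definable :: "nat \<Rightarrow> (nat \<Rightarrow> rat) \<Rightarrow> (nat \<Rightarrow> rat) set \<Rightarrow> bool" where
  "padic_definable p f x \<longleftrightarrow>
     (\<exists>L. limitin (Qp_topology p) (\<lambda>n. padic_of_rat p (f (padic_trunc p x n))) L sequentially)"

section \<open>Basic properties\<close>

lemma padic_val_divide:
  assumes "prime p" "a \<noteq> 0" "b \<noteq> 0"
  shows "padic_val p (of_int a / of_int b)
         = int (multiplicity (int p) a) - int (multiplicity (int p) b)"
proof -
  define x :: rat where "x = of_int a / of_int b"
  obtain c d where cd: "quotient_of x = (c, d)" by force
  have d: "d > 0" using quotient_of_denom_pos[OF cd] .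
  have x: "x = of_int c / of_int d" using quotient_of_div[OF cd] .
  have "x \<noteq> 0" using assms by (simp add: x_def)
  hence c: "c \<noteq> 0" using x by auto
  have "(of_int (a * d) :: rat) = of_int (c * b)"
    using x x_def assms d by (simp add: field_simps)
  hence eq: "a * d = c * b" by (simp only: of_int_eq_iff)
  have pe: "prime_elem (int p)" using assms by (simp add: prime_imp_prime_elem)
  have "multiplicity (int p) (a * d) = multiplicity (int p) a + multiplicity (int p) d"
    using pe assms d by (intro prime_elem_multiplicity_mult_distrib) auto
  moreover have "multiplicity (int p) (c * b) = multiplicity (int p) c + multiplicity (int p) b"
    using pe assms c by (intro prime_elem_multiplicity_mult_distrib) auto
  ultimately have "multiplicity (int p) a + multiplicity (int p) d
                   = multiplicity (int p) c + multiplicity (int p) b"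
    using eq by simp
  thus ?thesis unfolding x_def[symmetric] padic_val_def cd by simp
qed

lemma padic_abs_0 [simp]: "padic_abs p 0 = 0"
  by (simp add: padic_abs_def)

lemma padic_abs_nonneg [simp]: "padic_abs p x \<ge> 0"
  by (simp add: padic_abs_def)

lemma padic_abs_eq_0_iff: "prime p \<Longrightarrow> padic_abs p x = 0 \<longleftrightarrow> x = 0"
  by (auto simp: padic_abs_def dest: prime_gt_0_nat)

lemma multiplicity_minus_right: "multiplicity (q :: int) (- a) = multiplicity q a"
  using multiplicity_times_unit_right[of "- 1 :: int" q a] by simp

lemma padic_abs_minus: "padic_abs p (- x) = padic_abs p x"
proof -
  obtain c d where cd: "quotient_of x = (c, d)" by force
  show ?thesis
    by (simp add: padic_abs_def padic_val_def rat_uminus_code cd multiplicity_minus_right)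
qed

lemma padic_abs_minus_commute: "padic_abs p (x - y) = padic_abs p (y - x)"
  using padic_abs_minus[of p "x - y"] by simp

lemma common_denominator:
  fixes x y :: rat
  obtains a b n :: int where "n \<noteq> 0" "x = of_int a / of_int n" "y = of_int b / of_int n"
proof -
  obtain c d where cd: "quotient_of x = (c, d)" by force
  obtain e f where ef: "quotient_of y = (e, f)" by force
  have "d > 0" "f > 0"
    using quotient_of_denom_pos[OF cd] quotient_of_denom_pos[OF ef] by auto
  thus ?thesis
    using quotient_of_div[OF cd] quotient_of_div[OF ef] that[of "d * f" "c * f" "e * d"]
    by (simp add: field_simps)
qed

lemma padic_abs_mult:
  assumes "prime p"
  shows "padic_abs p (x * y) = padic_abs p x * padic_abs p y"
proof (cases "x = 0 \<or> y = 0")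
  case False
  obtain a b n where n: "n \<noteq> 0" and x: "x = of_int a / of_int n" and y: "y = of_int b / of_int n"
    by (rule common_denominator)
  have ab: "a \<noteq> 0" "b \<noteq> 0" using False x y by auto
  have pe: "prime_elem (int p)" using assms by (simp add: prime_imp_prime_elem)
  have "x * y = of_int (a * b) / of_int (n * n)" by (simp add: x y)
  hence "padic_val p (x * y) = padic_val p x + padic_val p y"
    using padic_val_divide[OF assms, of "a * b" "n * n"] padic_val_divide[OF assms ab(1) n]
      padic_val_divide[OF assms ab(2) n] ab n pe
    by (simp add: x y prime_elem_multiplicity_mult_distrib)
  thus ?thesis using False assms prime_gt_0_nat[OF assms]
    by (simp add: padic_abs_def power_int_add[symmetric])
qed auto

lemma padic_abs_add_le:
  assumes "prime p"
  shows "padic_abs p (x + y) \<le> max (padic_abs p x) (padic_abs p y)"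
proof (cases "x = 0 \<or> y = 0 \<or> x + y = 0")
  case False
  obtain a b n where n: "n \<noteq> 0" and x: "x = of_int a / of_int n" and y: "y = of_int b / of_int n"
    by (rule common_denominator)
  have ab: "a \<noteq> 0" "b \<noteq> 0" using False x y by auto
  have xy: "x + y = of_int (a + b) / of_int n" by (simp add: x y add_divide_distrib)
  hence ab': "a + b \<noteq> 0" using False by auto
  define m where "m = min (multiplicity (int p) a) (multiplicity (int p) b)"
  have "int p ^ m dvd a + b"
    by (intro dvd_add multiplicity_dvd') (auto simp: m_def)
  hence "m \<le> multiplicity (int p) (a + b)"
    using ab' assms by (intro multiplicity_geI) auto
  hence "padic_val p (x + y) \<ge> min (padic_val p x) (padic_val p y)"
    using padic_val_divide[OF assms ab' n] padic_val_divide[OF assms ab(1) n]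
      padic_val_divide[OF assms ab(2) n]
    unfolding xy by (auto simp: x y m_def)
  hence "- padic_val p (x + y) \<le> - padic_val p x \<or> - padic_val p (x + y) \<le> - padic_val p y"
    by linarith
  hence "real p powi (- padic_val p (x + y)) \<le> real p powi (- padic_val p x) \<or>
         real p powi (- padic_val p (x + y)) \<le> real p powi (- padic_val p y)"
    using prime_gt_1_nat[OF assms] by (auto intro!: power_int_increasing)
  thus ?thesis using False by (auto simp: padic_abs_def)
qed (auto simp: le_max_iff_disj)

lemma padic_abs_triangle:
  assumes "prime p"
  shows "padic_abs p (x + y) \<le> padic_abs p x + padic_abs p y"
  using padic_abs_add_le[OF assms, of x y] padic_abs_nonneg[of p x] padic_abs_nonneg[of p y]
  by linarith

lemma padic_abs_of_int_less_iff:
  assumes "prime p"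
  shows "padic_abs p (of_int a) < 1 / real p ^ m \<longleftrightarrow> int p ^ Suc m dvd a"
proof (cases "a = 0")
  case False
  have p: "real p > 1" using prime_gt_1_nat[OF assms] by simp
  have "padic_val p (of_int a) = int (multiplicity (int p) a)"
    using padic_val_divide[OF assms False, of 1] by simp
  hence "padic_abs p (of_int a) = 1 / real p ^ multiplicity (int p) a"
    using False by (simp add: padic_abs_def power_int_minus divide_inverse)
  moreover have "1 / real p ^ multiplicity (int p) a < 1 / real p ^ m
                 \<longleftrightarrow> m < multiplicity (int p) a"
    using p by (simp add: field_simps)
  moreover have "int p ^ Suc m dvd a \<longleftrightarrow> Suc m \<le> multiplicity (int p) a"
    using False assms by (intro power_dvd_iff_le_multiplicity) auto
  ultimately show ?thesis by auto
qed (use prime_gt_0_nat[OF assms] in auto)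

lemma Metric_space_padic_rat:
  assumes "prime p"
  shows "Metric_space UNIV (\<lambda>x y. padic_abs p (x - y))"
proof
  fix x y z :: rat
  show "padic_abs p (x - z) \<le> padic_abs p (x - y) + padic_abs p (y - z)"
    using padic_abs_triangle[OF assms, of "x - y" "y - z"] by simp
qed (use assms in \<open>auto simp: padic_abs_eq_0_iff intro: padic_abs_minus_commute\<close>)

lemma padic_Cauchy_iff:
  assumes "prime p"
  shows "X \<in> padic_Cauchy p
         \<longleftrightarrow> (\<forall>e>0. \<exists>N. \<forall>m n. N \<le> m \<longrightarrow> N \<le> n \<longrightarrow> padic_abs p (X m - X n) < e)"
  unfolding padic_Cauchy_def using Metric_space.MCauchy_def[OF Metric_space_padic_rat[OF assms]]
  by simp

lemma padic_Cauchy_const [simp]: "prime p \<Longrightarrow> (\<lambda>_. q) \<in> padic_Cauchy p"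
  by (simp add: padic_Cauchy_iff)

lemma equiv_padic_rel:
  assumes "prime p"
  shows "equiv (padic_Cauchy p) (padic_rel p)"
proof (rule equivI)
  show "padic_rel p \<subseteq> padic_Cauchy p \<times> padic_Cauchy p"
    by (auto simp: padic_rel_def)
  show "refl_on (padic_Cauchy p) (padic_rel p)"
    by (auto simp: refl_on_def padic_rel_def)
  show "sym (padic_rel p)"
    by (auto simp: sym_def padic_rel_def padic_abs_minus_commute)
  show "trans (padic_rel p)"
  proof (rule transI)
    fix X Y Z assume a: "(X, Y) \<in> padic_rel p" "(Y, Z) \<in> padic_rel p"
    have "(\<lambda>n. padic_abs p (X n - Y n) + padic_abs p (Y n - Z n)) \<longlonglongrightarrow> 0 + 0"
      using a by (intro tendsto_add) (auto simp: padic_rel_def)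
    hence lim0: "(\<lambda>n. padic_abs p (X n - Y n) + padic_abs p (Y n - Z n)) \<longlonglongrightarrow> 0" by simp
    have "norm (padic_abs p (X n - Z n))
                   \<le> padic_abs p (X n - Y n) + padic_abs p (Y n - Z n)" for n
      using padic_abs_triangle[OF assms, of "X n - Y n" "Y n - Z n"] by simp
    hence "(\<lambda>n. padic_abs p (X n - Z n)) \<longlonglongrightarrow> 0"
      by (intro Lim_null_comparison[OF always_eventually lim0]) blast
    thus "(X, Z) \<in> padic_rel p" using a by (auto simp: padic_rel_def)
  qed
qed

lemma padic_dist_convergent:
  assumes "prime p" "X \<in> padic_Cauchy p" "Y \<in> padic_Cauchy p"
  shows "convergent (\<lambda>n. padic_abs p (X n - Y n))"
proof -
  interpret R: Metric_space UNIV "\<lambda>x y. padic_abs p (x - y)"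
    by (rule Metric_space_padic_rat) fact
  have "Cauchy (\<lambda>n. padic_abs p (X n - Y n))"
  proof (rule metric_CauchyI)
    fix e :: real assume "e > 0"
    hence e: "e / 2 > 0" by simp
    obtain N1 where N1: "\<And>m n. N1 \<le> m \<Longrightarrow> N1 \<le> n \<Longrightarrow> padic_abs p (X m - X n) < e / 2"
      using assms(2) e unfolding padic_Cauchy_iff[OF assms(1)] by blast
    obtain N2 where N2: "\<And>m n. N2 \<le> m \<Longrightarrow> N2 \<le> n \<Longrightarrow> padic_abs p (Y m - Y n) < e / 2"
      using assms(3) e unfolding padic_Cauchy_iff[OF assms(1)] by blast
    show "\<exists>M. \<forall>m\<ge>M. \<forall>n\<ge>M. dist (padic_abs p (X m - Y m)) (padic_abs p (X n - Y n)) < e"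
    proof (intro exI allI impI)
      fix m n assume mn: "max N1 N2 \<le> m" "max N1 N2 \<le> n"
      have "padic_abs p (X m - X n) < e / 2" "padic_abs p (Y m - Y n) < e / 2"
        using N1[of m n] N2[of m n] mn by auto
      thus "dist (padic_abs p (X m - Y m)) (padic_abs p (X n - Y n)) < e"
        using R.triangle[of "X m" "X n" "Y m"] R.triangle[of "X n" "Y n" "Y m"]
          R.triangle[of "X n" "X m" "Y n"] R.triangle[of "X m" "Y m" "Y n"]
        by (simp add: dist_real_def R.commute[of "X n" "X m"] R.commute[of "Y n" "Y m"])
    qed
  qed
  thus ?thesis by (simp add: Cauchy_convergent)
qed

lemma padic_dist_tendsto:
  assumes p: "prime p" and x: "x \<in> Qp p" and y: "y \<in> Qp p" and X: "X \<in> x" and Y: "Y \<in> y"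
  shows "(\<lambda>n. padic_abs p (X n - Y n)) \<longlonglongrightarrow> padic_dist p x y"
proof -
  note eq = equiv_padic_rel[OF p]
  interpret R: Metric_space UNIV "\<lambda>x y. padic_abs p (x - y)"
    by (rule Metric_space_padic_rat) fact
  have C: "X \<in> padic_Cauchy p" "Y \<in> padic_Cauchy p"
    using in_quotient_imp_subset[OF eq] x y X Y unfolding Qp_def by blast+
  obtain r where r: "(\<lambda>n. padic_abs p (X n - Y n)) \<longlonglongrightarrow> r"
    using padic_dist_convergent[OF p C] by (auto simp: convergent_def)
  have all: "(\<lambda>n. padic_abs p (X' n - Y' n)) \<longlonglongrightarrow> r" if "X' \<in> x" "Y' \<in> y" for X' Y'
  proof -
    have "(X, X') \<in> padic_rel p" "(Y, Y') \<in> padic_rel p"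
      using quotient_eq_iff[OF eq] x y X Y that unfolding Qp_def by blast+
    hence "(\<lambda>n. padic_abs p (X n - X' n) + padic_abs p (Y n - Y' n)) \<longlonglongrightarrow> 0 + 0"
      by (intro tendsto_add) (auto simp: padic_rel_def)
    hence lim0: "(\<lambda>n. padic_abs p (X n - X' n) + padic_abs p (Y n - Y' n)) \<longlonglongrightarrow> 0" by simp
    have "(\<lambda>n. padic_abs p (X' n - Y' n) - padic_abs p (X n - Y n)) \<longlonglongrightarrow> 0"
    proof (rule Lim_null_comparison[OF _ lim0])
      have "\<bar>padic_abs p (X' n - Y' n) - padic_abs p (X n - Y n)\<bar>
            \<le> padic_abs p (X n - X' n) + padic_abs p (Y n - Y' n)" for n
        using R.triangle[of "X n" "X' n" "Y n"] R.triangle[of "X' n" "Y' n" "Y n"]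
          R.triangle[of "X' n" "X n" "Y' n"] R.triangle[of "X n" "Y n" "Y' n"]
        by (simp add: R.commute[of "X' n" "X n"] R.commute[of "Y' n" "Y n"])
      thus "\<forall>\<^sub>F n in sequentially. norm (padic_abs p (X' n - Y' n) - padic_abs p (X n - Y n))
              \<le> padic_abs p (X n - X' n) + padic_abs p (Y n - Y' n)" by simp
    qed
    from tendsto_add[OF this r] show ?thesis by simp
  qed
  have "padic_dist p x y = r"
    unfolding padic_dist_def if_P[OF conjI[OF x y]]
  proof (rule the_equality)
    fix s assume "\<forall>X\<in>x. \<forall>Y\<in>y. (\<lambda>n. padic_abs p (X n - Y n)) \<longlonglongrightarrow> s"
    thus "s = r" using X Y LIMSEQ_unique r by blast
  qed (use all in blast)
  thus ?thesis using r by simp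
qed

lemma Qp_representative:
  assumes "prime p" "x \<in> Qp p"
  obtains X where "X \<in> x" "X \<in> padic_Cauchy p" "x = padic_rel p `` {X}"
  using assms(2) equiv_class_self[OF equiv_padic_rel[OF assms(1)]] unfolding Qp_def
  by (elim quotientE) blast

lemma Qp_ex: "prime p \<Longrightarrow> x \<in> Qp p \<Longrightarrow> \<exists>X\<in>x. X \<in> padic_Cauchy p"
  using Qp_representative[of p x] by blast

lemma Metric_space_Qp:
  assumes p: "prime p"
  shows "Metric_space (Qp p) (padic_dist p)"
proof
  interpret R: Metric_space UNIV "\<lambda>x y. padic_abs p (x - y)"
    by (rule Metric_space_padic_rat) fact
  have nonneg: "0 \<le> padic_dist p x y" if xy: "x \<in> Qp p" "y \<in> Qp p" for x y
  proof -
    obtain X Y where "X \<in> x" "Y \<in> y" using xy Qp_ex[OF p] by blast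
    from padic_dist_tendsto[OF p that this] show ?thesis by (rule LIMSEQ_le_const) auto
  qed
  show "padic_dist p x y = padic_dist p y x" for x y
  proof (cases "x \<in> Qp p \<and> y \<in> Qp p")
    case True
    then obtain X Y where XY: "X \<in> x" "Y \<in> y" using Qp_ex[OF p] by blast
    have "(\<lambda>n. padic_abs p (X n - Y n)) \<longlonglongrightarrow> padic_dist p y x"
      using padic_dist_tendsto[OF p _ _ XY(2,1)] True by (simp add: R.commute)
    thus ?thesis using padic_dist_tendsto[OF p _ _ XY] True LIMSEQ_unique by blast
  qed (auto simp: padic_dist_def)
  show "0 \<le> padic_dist p x y" for x y
    using nonneg by (cases "x \<in> Qp p \<and> y \<in> Qp p") (auto simp: padic_dist_def)
  show "padic_dist p x y = 0 \<longleftrightarrow> x = y" if xy: "x \<in> Qp p" "y \<in> Qp p" for x y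
  proof -
    obtain X Y where XY: "X \<in> x" "Y \<in> y" "X \<in> padic_Cauchy p" "Y \<in> padic_Cauchy p"
      using xy Qp_ex[OF p] by blast
    note l = padic_dist_tendsto[OF p that XY(1,2)]
    have "padic_dist p x y = 0 \<longleftrightarrow> (X, Y) \<in> padic_rel p"
    proof
      assume "padic_dist p x y = 0"
      thus "(X, Y) \<in> padic_rel p" using l XY by (simp add: padic_rel_def)
    next
      assume "(X, Y) \<in> padic_rel p"
      hence "(\<lambda>n. padic_abs p (X n - Y n)) \<longlonglongrightarrow> 0" by (simp add: padic_rel_def)
      thus "padic_dist p x y = 0" by (rule LIMSEQ_unique[OF l])
    qed
    also have "\<dots> \<longleftrightarrow> x = y"
      using quotient_eq_iff[OF equiv_padic_rel[OF p]] xy XY unfolding Qp_def by metis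
    finally show ?thesis .
  qed
  show "padic_dist p x z \<le> padic_dist p x y + padic_dist p y z"
    if xy: "x \<in> Qp p" "y \<in> Qp p" "z \<in> Qp p" for x y z
  proof -
    obtain X where X: "X \<in> x" using Qp_ex[OF p xy(1)] by blast
    obtain Y where Y: "Y \<in> y" using Qp_ex[OF p xy(2)] by blast
    obtain Z where Z: "Z \<in> z" using Qp_ex[OF p xy(3)] by blast
    have "padic_abs p (X n - Z n) \<le> padic_abs p (X n - Y n) + padic_abs p (Y n - Z n)" for n
      by (rule R.triangle) auto
    hence "\<exists>N. \<forall>n\<ge>N. padic_abs p (X n - Z n)
                      \<le> padic_abs p (X n - Y n) + padic_abs p (Y n - Z n)" by blast
    thus ?thesis
      by (rule LIMSEQ_le[OF padic_dist_tendsto[OF p xy(1,3) X Z]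
            tendsto_add[OF padic_dist_tendsto[OF p xy(1,2) X Y]
                           padic_dist_tendsto[OF p xy(2,3) Y Z]]])
  qed
qed

lemma padic_of_rat_in_Qp [simp]: "prime p \<Longrightarrow> padic_of_rat p q \<in> Qp p"
  unfolding padic_of_rat_def Qp_def by (intro quotientI) simp

lemma padic_dist_of_rat_tendsto:
  assumes p: "prime p" and X: "X \<in> padic_Cauchy p"
  shows "(\<lambda>n. padic_abs p (X n - q)) \<longlonglongrightarrow> padic_dist p (padic_rel p `` {X}) (padic_of_rat p q)"
proof (rule padic_dist_tendsto[OF p])
  show "padic_rel p `` {X} \<in> Qp p" using X unfolding Qp_def by (rule quotientI)
  show "X \<in> padic_rel p `` {X}" using equiv_class_self[OF equiv_padic_rel[OF p] X] .
  show "(\<lambda>_. q) \<in> padic_of_rat p q"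
    unfolding padic_of_rat_def using equiv_class_self[OF equiv_padic_rel[OF p]] p by simp
qed (use p in simp)

lemma padic_dist_of_rat [simp]:
  assumes "prime p"
  shows "padic_dist p (padic_of_rat p q) (padic_of_rat p r) = padic_abs p (q - r)"
  using LIMSEQ_unique[OF padic_dist_of_rat_tendsto[OF assms, of "\<lambda>_. q" r] tendsto_const] assms
  by (simp add: padic_of_rat_def)

lemma padic_dist_Cauchy_less:
  assumes p: "prime p" and X: "X \<in> padic_Cauchy p" and e: "e > 0"
  shows "\<exists>N. \<forall>n\<ge>N. padic_dist p (padic_rel p `` {X}) (padic_of_rat p (X n)) < e"
proof -
  obtain N where N: "\<And>m n. N \<le> m \<Longrightarrow> N \<le> n \<Longrightarrow> padic_abs p (X m - X n) < e / 2"
    using X half_gt_zero[OF e] unfolding padic_Cauchy_iff[OF p] by blast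
  have "padic_dist p (padic_rel p `` {X}) (padic_of_rat p (X n)) \<le> e / 2" if "n \<ge> N" for n
    by (rule LIMSEQ_le_const2[OF padic_dist_of_rat_tendsto[OF p X]])
       (use N that in \<open>auto intro!: exI[of _ N] less_imp_le\<close>)
  thus ?thesis using e by (intro exI[of _ N]) force
qed

lemma Qp_dense:
  assumes p: "prime p" and x: "x \<in> Qp p" and e: "e > 0"
  obtains q where "padic_dist p x (padic_of_rat p q) < e"
proof -
  obtain X where X: "X \<in> padic_Cauchy p" "x = padic_rel p `` {X}"
    using Qp_representative[OF p x] by blast
  obtain N where "\<forall>n\<ge>N. padic_dist p x (padic_of_rat p (X n)) < e"
    using padic_dist_Cauchy_less[OF p X(1) e] X(2) by blast
  thus ?thesis using that by blast
qed

lemma mcomplete_Qp: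
  assumes p: "prime p"
  shows "Metric_space.mcomplete (Qp p) (padic_dist p)"
proof -
  interpret Metric_space "Qp p" "padic_dist p" by (rule Metric_space_Qp) fact
  show ?thesis unfolding mcomplete_def
  proof (intro allI impI)
    fix \<sigma> assume "MCauchy \<sigma>"
    hence "range \<sigma> \<subseteq> Qp p" unfolding MCauchy_def by (rule conjunct1)
    hence \<sigma>: "\<sigma> n \<in> Qp p" for n by (rule subsetD) (rule rangeI)
    have "\<exists>q. padic_dist p (\<sigma> n) (padic_of_rat p q) < 1 / real (Suc n)" for n
      using Qp_dense[OF p \<sigma>, of "1 / real (Suc n)" n] by auto
    then obtain X where X: "\<And>n. padic_dist p (\<sigma> n) (padic_of_rat p (X n)) < 1 / real (Suc n)"
      by metis
    have small: "\<exists>N. \<forall>n\<ge>N. padic_dist p (\<sigma> n) (padic_of_rat p (X n)) < e" if e: "e > 0" for e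
    proof -
      obtain N where N: "1 / real (Suc N) < e" by (rule nat_approx_posE[OF e])
      have "padic_dist p (\<sigma> n) (padic_of_rat p (X n)) < e" if "n \<ge> N" for n
      proof -
        have "1 / real (Suc n) \<le> 1 / real (Suc N)" using that by (simp add: field_simps)
        thus ?thesis using X[of n] N by linarith
      qed
      thus ?thesis by blast
    qed
    have XC: "X \<in> padic_Cauchy p"
      unfolding padic_Cauchy_iff[OF p]
    proof (intro allI impI)
      fix e :: real assume "e > 0"
      hence e: "e / 3 > 0" by simp
      obtain N1 where N1: "\<And>n. n \<ge> N1 \<Longrightarrow> padic_dist p (\<sigma> n) (padic_of_rat p (X n)) < e / 3"
        using small[OF e] by blast
      obtain N2 where N2: "\<And>m n. N2 \<le> m \<Longrightarrow> N2 \<le> n \<Longrightarrow> padic_dist p (\<sigma> m) (\<sigma> n) < e / 3"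
        using \<open>MCauchy \<sigma>\<close> e unfolding MCauchy_def by blast
      have "padic_abs p (X m - X n) < e" if "max N1 N2 \<le> m" "max N1 N2 \<le> n" for m n
      proof -
        have "padic_abs p (X m - X n) = padic_dist p (padic_of_rat p (X m)) (padic_of_rat p (X n))"
          using p by simp
        also have "\<dots> \<le> padic_dist p (padic_of_rat p (X m)) (\<sigma> m)
                         + padic_dist p (\<sigma> m) (padic_of_rat p (X n))"
          using p \<sigma> by (intro triangle) auto
        also have "padic_dist p (\<sigma> m) (padic_of_rat p (X n))
                   \<le> padic_dist p (\<sigma> m) (\<sigma> n) + padic_dist p (\<sigma> n) (padic_of_rat p (X n))"
          using p \<sigma> by (intro triangle) auto
        finally show ?thesis
          using N1[of m] N1[of n] N2[of m n] that
            commute[of "padic_of_rat p (X m)" "\<sigma> m"] by simp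
      qed
      thus "\<exists>N. \<forall>m n. N \<le> m \<longrightarrow> N \<le> n \<longrightarrow> padic_abs p (X m - X n) < e" by blast
    qed
    define L where "L = padic_rel p `` {X}"
    have L: "L \<in> Qp p" using XC unfolding Qp_def L_def by (rule quotientI)
    have "limitin mtopology \<sigma> L sequentially"
      unfolding limit_metric_sequentially
    proof (intro conjI allI impI)
      fix e :: real assume "e > 0"
      hence e: "e / 2 > 0" by simp
      obtain N1 where N1: "\<And>n. n \<ge> N1 \<Longrightarrow> padic_dist p (\<sigma> n) (padic_of_rat p (X n)) < e / 2"
        using small[OF e] by blast
      obtain N2 where N2: "\<And>n. n \<ge> N2 \<Longrightarrow> padic_dist p L (padic_of_rat p (X n)) < e / 2"
        using padic_dist_Cauchy_less[OF p XC e] unfolding L_def by blast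
      show "\<exists>N. \<forall>n\<ge>N. \<sigma> n \<in> Qp p \<and> padic_dist p (\<sigma> n) L < e"
      proof (intro exI allI impI conjI)
        fix n assume n: "n \<ge> max N1 N2"
        have "padic_dist p (\<sigma> n) L \<le> padic_dist p (\<sigma> n) (padic_of_rat p (X n))
                                      + padic_dist p (padic_of_rat p (X n)) L"
          using p \<sigma> L by (intro triangle) auto
        thus "padic_dist p (\<sigma> n) L < e"
          using N1[of n] N2[of n] n commute[of L "padic_of_rat p (X n)"] by simp
      qed (rule \<sigma>)
    qed (rule L)
    thus "\<exists>x. limitin mtopology \<sigma> x sequentially" by blast
  qed
qed

lemma digit_sum_less:
  assumes "\<And>i. \<epsilon> i < (p :: nat)"
  shows "(\<Sum>i\<le>n. \<epsilon> i * p ^ i) < p ^ Suc n"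
proof (induction n)
  case (Suc n)
  have "(\<Sum>i\<le>Suc n. \<epsilon> i * p ^ i) < p ^ Suc n + \<epsilon> (Suc n) * p ^ Suc n"
    using Suc by simp
  also have "\<dots> = Suc (\<epsilon> (Suc n)) * p ^ Suc n" by simp
  also have "\<dots> \<le> p * p ^ Suc n"
    using assms[of "Suc n"] by (intro mult_right_mono) auto
  finally show ?case by simp
qed (use assms in auto)

lemma digit_sum_mod:
  assumes "\<And>i. \<epsilon> i < (p :: nat)" "m \<le> n"
  shows "(\<Sum>i\<le>n. \<epsilon> i * p ^ i) mod p ^ Suc m = (\<Sum>i\<le>m. \<epsilon> i * p ^ i)"
  using assms(2)
proof (induction n rule: dec_induct)
  case base
  show ?case using digit_sum_less[OF assms(1)] by (rule mod_less)
next
  case (step n)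
  have "p ^ Suc m dvd p ^ Suc n" using step by (intro le_imp_power_dvd) auto
  hence "p ^ Suc m dvd \<epsilon> (Suc n) * p ^ Suc n" by (rule dvd_mult)
  then obtain c where c: "\<epsilon> (Suc n) * p ^ Suc n = p ^ Suc m * c" by (rule dvdE)
  have "(\<Sum>i\<le>Suc n. \<epsilon> i * p ^ i) mod p ^ Suc m = (\<Sum>i\<le>n. \<epsilon> i * p ^ i) mod p ^ Suc m"
    unfolding sum.atMost_Suc c by (rule mod_mult_self2)
  thus ?case using step by simp
qed

lemma padic_expansion_unique:
  assumes p: "prime p" and e: "padic_expansion p x \<epsilon>" and d: "padic_expansion p x \<delta>"
  shows "\<epsilon> = \<delta>"
proof -
  interpret Metric_space "Qp p" "padic_dist p" by (rule Metric_space_Qp) fact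
  define s where "s = (\<lambda>n. \<Sum>i\<le>n. \<epsilon> i * p ^ i)"
  define t where "t = (\<lambda>n. \<Sum>i\<le>n. \<delta> i * p ^ i)"
  have lt: "\<And>i. \<epsilon> i < p" "\<And>i. \<delta> i < p" using e d by (auto simp: padic_expansion_def)
  have x: "x \<in> Qp p"
    using e by (auto simp: padic_expansion_def Qp_topology_def limit_metric_sequentially)
  have st: "s m = t m" for m
  proof -
    have pos: "1 / real p ^ m / 2 > 0" using prime_gt_0_nat[OF p] by simp
    obtain N1 where N1: "\<And>n. n \<ge> N1 \<Longrightarrow>
        padic_dist p (padic_of_rat p (of_nat (s n))) x < 1 / real p ^ m / 2"
      using e pos unfolding padic_expansion_def Qp_topology_def limit_metric_sequentially s_def
      by blast
    obtain N2 where N2: "\<And>n. n \<ge> N2 \<Longrightarrow>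
        padic_dist p (padic_of_rat p (of_nat (t n))) x < 1 / real p ^ m / 2"
      using d pos unfolding padic_expansion_def Qp_topology_def limit_metric_sequentially t_def
      by blast
    define n where "n = max m (max N1 N2)"
    have "padic_abs p (of_int (int (s n) - int (t n)))
          = padic_dist p (padic_of_rat p (of_nat (s n))) (padic_of_rat p (of_nat (t n)))"
      using p by simp
    also have "\<dots> \<le> padic_dist p (padic_of_rat p (of_nat (s n))) x
                    + padic_dist p x (padic_of_rat p (of_nat (t n)))"
      using p x by (intro triangle) auto
    also have "\<dots> < 1 / real p ^ m / 2 + 1 / real p ^ m / 2"
      unfolding commute[of x "padic_of_rat p (of_nat (t n))"]
      by (intro add_strict_mono N1 N2) (auto simp: n_def)
    also have "\<dots> = 1 / real p ^ m" by simp
    finally have "int p ^ Suc m dvd int (s n) - int (t n)"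
      by (simp only: padic_abs_of_int_less_iff[OF p])
    hence "int (s n) mod int (p ^ Suc m) = int (t n) mod int (p ^ Suc m)"
      by (simp add: mod_eq_dvd_iff)
    hence "s n mod p ^ Suc m = t n mod p ^ Suc m" by (simp only: zmod_int[symmetric] of_nat_eq_iff)
    moreover have "s n mod p ^ Suc m = s m" "t n mod p ^ Suc m = t m"
      unfolding s_def t_def using lt by (intro digit_sum_mod; simp add: n_def)+
    ultimately show ?thesis by simp
  qed
  have "\<epsilon> i = \<delta> i" for i
  proof (cases i)
    case 0
    thus ?thesis using st[of 0] by (simp add: s_def t_def)
  next
    case (Suc j)
    thus ?thesis using st[of j] st[of "Suc j"] prime_gt_0_nat[OF p] by (simp add: s_def t_def)
  qed
  thus ?thesis by blast
qed

lemma padic_digits_eqI: "prime p \<Longrightarrow> padic_expansion p x \<epsilon> \<Longrightarrow> padic_digits p x = \<epsilon>"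
  unfolding padic_digits_def by (rule the_equality) (auto intro: padic_expansion_unique)

lemma int_digit_sum:
  assumes "(p :: nat) > 0"
  shows "int (\<Sum>i\<le>n. nat (a div int p ^ i mod int p) * p ^ i) = a mod int p ^ Suc n"
proof (induction n)
  case (Suc n)
  have "a mod (int p ^ Suc n * int p) = int p ^ Suc n * (a div int p ^ Suc n mod int p)
          + a mod int p ^ Suc n"
    using assms by (intro zmod_zmult2_eq) auto
  thus ?case using Suc assms by (simp add: mult_ac)
qed (use assms in auto)

lemma padic_expansion_of_int:
  assumes p: "prime p"
  shows "padic_expansion p (padic_of_rat p (of_int a)) (\<lambda>i. nat (a div int p ^ i mod int p))"
proof -
  interpret Metric_space "Qp p" "padic_dist p" by (rule Metric_space_Qp) fact
  have p0: "p > 0" and p1: "real p > 1" using prime_gt_1_nat[OF p] by auto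
  define s where "s = (\<lambda>n. \<Sum>i\<le>n. nat (a div int p ^ i mod int p) * p ^ i)"
  have less: "padic_abs p (of_nat (s n) - of_int a) < 1 / real p ^ n" for n
  proof -
    have "int p ^ Suc n dvd int (s n) - a"
      unfolding s_def int_digit_sum[OF p0] by (simp add: mod_eq_dvd_iff[symmetric])
    hence "padic_abs p (of_int (int (s n) - a)) < 1 / real p ^ n"
      by (simp only: padic_abs_of_int_less_iff[OF p])
    thus ?thesis by simp
  qed
  have "limitin mtopology (\<lambda>n. padic_of_rat p (of_nat (s n))) (padic_of_rat p (of_int a)) sequentially"
    unfolding limitin_metric_dist_null
  proof (intro conjI)
    have "(\<lambda>n. (1 / real p) ^ n) \<longlonglongrightarrow> 0" using p1 by (intro LIMSEQ_realpow_zero) auto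
    hence lim0: "(\<lambda>n. 1 / real p ^ n) \<longlonglongrightarrow> 0" by (simp add: power_one_over)
    have "norm (padic_abs p (of_nat (s n) - of_int a)) \<le> 1 / real p ^ n" for n
      using less[of n] by simp
    hence "(\<lambda>n. padic_abs p (of_nat (s n) - of_int a)) \<longlonglongrightarrow> 0"
      by (intro Lim_null_comparison[OF always_eventually lim0]) blast
    thus "(\<lambda>n. padic_dist p (padic_of_rat p (of_nat (s n))) (padic_of_rat p (of_int a))) \<longlonglongrightarrow> 0"
      using p by simp
  qed (use p in auto)
  thus ?thesis using p0
    unfolding padic_expansion_def Qp_topology_def s_def by (auto simp: nat_less_iff)
qed

lemma padic_of_int_in_Zp: "prime p \<Longrightarrow> padic_of_rat p (of_int a) \<in> Zp p"
  unfolding Zp_def using padic_expansion_of_int[of p a] padic_of_rat_in_Qp[of p "of_int a"] by blast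

lemma padic_trunc_of_int:
  assumes p: "prime p"
  shows "padic_trunc p (padic_of_rat p (of_int a)) n = nat (a mod int p ^ Suc n)"
  using int_digit_sum[OF prime_gt_0_nat[OF p], where n = n and a = a, symmetric]
  unfolding padic_trunc_def padic_digits_eqI[OF p padic_expansion_of_int[OF p]]
  by (simp only: nat_int)

end

theory Submission
  imports Defs "HOL-Number_Theory.Residues"
begin

text \<open>
  Let \<open>f\<close> be the sum of the inverses of the binomial coefficients; the truncations of \<open>- k - 1\<close> are
  eventually \<open>p ^ m - k - 1\<close>. The absolute values of \<open>f\<close> at these points tend to infinity.
  By the recurrence \<open>2 (f (n + 1) - 1) = (n + 2) / (n + 1) * f n\<close>, passing from \<open>k\<close> to \<open>k + 1\<close>
  multiplies a large absolute value by a constant, so that \<open>k = 1\<close> suffices. For \<open>n + 2 = p ^ m\<close> the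
  recurrence has the denominator \<open>p ^ m\<close>, so that it remains to bound \<open>f (N - 1) - 1\<close> away from \<open>0\<close>
  for \<open>N = p ^ m\<close>. If \<open>p = 2\<close>, all \<open>N - 1 choose j\<close> are odd, so \<open>f (N - 1)\<close> is even. For odd \<open>p\<close> use
  \<open>2 ^ (N - 1) * f (N - 1) = (\<Sum>i odd. (N / i)\<^sup>2 * (N - 1 choose i - 1))\<close>.
  The term \<open>i = N\<close> is \<open>1\<close>, and the others add up to a multiple of \<open>p ^ 2\<close>, and of \<open>p ^ 3\<close> if \<open>p > 3\<close>.
  Therefore \<open>f (N - 1) - 1\<close> has the valuation of \<open>2 ^ (p - 1) - 1\<close> as long as this is at most \<open>1\<close>,
  or at most \<open>2\<close> if \<open>p > 3\<close>. The two Wieferich primes up to \<open>3511\<close> have valuation \<open>2\<close>.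
\<close>

section \<open>Sums of inverse binomial coefficients\<close>

definition inv_binomial_sum :: "nat \<Rightarrow> rat" where
  "inv_binomial_sum n = (\<Sum>j\<le>n. inverse (of_nat (n choose j)))"

text \<open>Absorption gives \<open>(n + 1 - j) * (Suc n choose j) = (n + 1) * (n choose j)\<close>
  and \<open>(j + 1) * (Suc n choose Suc j) = (n + 1) * (n choose j)\<close>. Over the common
  denominator the two numerators \<open>n + 1 - j\<close> and \<open>j + 1\<close> add up to
  \<open>n + 2\<close>.\<close>

lemma inverse_binomial_add:
  assumes "j \<le> n"
  shows "inverse (of_nat (Suc n choose j)) + inverse (of_nat (Suc n choose Suc j))
         = of_nat (n + 2) / of_nat (n + 1) * inverse (of_nat (n choose j) :: rat)"
proof -
  define a b c :: rat where "a = of_nat (n choose j)" "b = of_nat (Suc n choose j)"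
    and "c = of_nat (Suc n choose Suc j)"
  have pos: "a > 0" "b > 0" "c > 0" using assms by (simp_all add: a_b_def c_def del: binomial_Suc_Suc)
  have "(Suc n - j) * (Suc n choose j) = Suc n * (n choose j)"
    using binomial_absorb_comp[of "Suc n" j] by simp
  hence "of_nat (Suc n - j) * b = of_nat (Suc n) * a"
    unfolding a_b_def by (simp only: of_nat_mult[symmetric])
  moreover have "of_nat (Suc n - j) = (of_nat n + 1 - of_nat j :: rat)"
    using assms by (simp add: of_nat_diff)
  ultimately have b: "(of_nat n + 1 - of_nat j) * b = (of_nat n + 1) * a"
    by (simp add: add.commute)
  have "of_nat (Suc j) * c = of_nat (Suc n) * a"
    unfolding a_b_def c_def by (simp only: of_nat_mult[symmetric] Suc_times_binomial)
  hence c: "(of_nat j + 1) * c = (of_nat n + 1) * a" by (simp add: add.commute)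
  have n: "(of_nat n + 1 :: rat) \<noteq> 0" by (simp add: add_eq_0_iff_both_eq_0 add_nonneg_pos pos_add_strict)
  hence nz: "(of_nat n + 1) * a \<noteq> 0" using pos by simp
  have "inverse b = (of_nat n + 1 - of_nat j) / ((of_nat n + 1) * a)"
    unfolding inverse_eq_divide using pos b by (subst frac_eq_eq[OF _ nz]) simp_all
  moreover have "inverse c = (of_nat j + 1) / ((of_nat n + 1) * a)"
    unfolding inverse_eq_divide using pos c by (subst frac_eq_eq[OF _ nz]) simp_all
  ultimately have "inverse b + inverse c
                   = ((of_nat n + 1 - of_nat j) + (of_nat j + 1)) / ((of_nat n + 1) * a)"
    by (simp only: add_divide_distrib)
  also have "\<dots> = (of_nat n + 2) / (of_nat n + 1) * inverse a"
    by (simp add: divide_inverse)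
  finally show ?thesis by (simp add: a_b_def c_def add.commute)
qed

text \<open>In the doubled sum every inverse is paired with its right neighbour; the two outermost
  inverses remain and contribute the 2.\<close>

lemma inv_binomial_sum_Suc:
  "2 * inv_binomial_sum (Suc n)
   = 2 + of_nat (n + 2) / of_nat (n + 1) * inv_binomial_sum n"
proof -
  let ?g = "\<lambda>j. inverse (of_nat (Suc n choose j) :: rat)"
  have "2 * inv_binomial_sum (Suc n) = sum ?g {..Suc n} + sum ?g {..Suc n}"
    by (simp only: inv_binomial_sum_def mult_2)
  also have "\<dots> = (sum ?g {..n} + 1) + (1 + (\<Sum>j\<le>n. ?g (Suc j)))"
    by (subst sum.atMost_Suc, subst sum.atMost_Suc_shift) simp
  also have "\<dots> = 2 + (\<Sum>j\<le>n. ?g j + ?g (Suc j))" by (simp only: sum.distrib)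
  also have "(\<Sum>j\<le>n. ?g j + ?g (Suc j))
             = (\<Sum>j\<le>n. of_nat (n + 2) / of_nat (n + 1) * inverse (of_nat (n choose j)))"
    by (intro sum.cong refl inverse_binomial_add) simp
  finally show ?thesis by (simp only: inv_binomial_sum_def sum_distrib_left)
qed

text \<open>By induction: the sum over odd indices, called \<open>g\<close>, grows by
  \<open>2 ^ m / (m + 1)\<close> from \<open>m\<close> to \<open>m + 1\<close>, which is what the
  recurrence for \<open>inv_binomial_sum\<close> requires.\<close>

lemma inv_binomial_sum_eq:
  "2 ^ n * inv_binomial_sum n
   = of_nat (Suc n) * (\<Sum>i\<le>Suc n. if odd i then of_nat (Suc n choose i) / of_nat i else 0)"
proof (induction n)
  case 0
  show ?case by (simp add: inv_binomial_sum_def)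
next
  case (Suc n)
  define g :: "nat \<Rightarrow> rat"
    where "g m = (\<Sum>i\<le>m. if odd i then of_nat (m choose i) / of_nat i else 0)" for m
  have "g (Suc m) - g m = 2 ^ m / of_nat (Suc m)" for m
  proof -
    \<comment> \<open>The added term contains \<open>m choose Suc m\<close>, which is 0, so both
      sums have the same range.\<close>
    have g: "g m = (\<Sum>i\<le>Suc m. if odd i then of_nat (m choose i) / of_nat i else 0)"
      by (simp add: g_def)
    have "g (Suc m) - g m
          = (\<Sum>i\<le>Suc m. if odd i then of_nat (Suc m choose i) / of_nat (Suc m) else 0)"
      unfolding g unfolding g_def sum_subtractf[symmetric]
    proof (intro sum.cong refl)
      fix i
      show "(if odd i then of_nat (Suc m choose i) / of_nat i else 0)
              - (if odd i then of_nat (m choose i) / of_nat i else 0)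
            = (if odd i then of_nat (Suc m choose i) / of_nat (Suc m) else 0 :: rat)"
      proof (cases i)
        case (Suc j)
        have "of_nat (Suc j * (Suc m choose Suc j)) = (of_nat (Suc m * (m choose j)) :: rat)"
          by (rule arg_cong[OF Suc_times_binomial])
        hence "of_nat (Suc j) * of_nat (Suc m choose Suc j) = (of_nat (Suc m) * of_nat (m choose j) :: rat)"
          by (simp only: of_nat_mult)
        hence "of_nat (m choose j) / of_nat (Suc j) = (of_nat (Suc m choose Suc j) / of_nat (Suc m) :: rat)"
          by (simp add: frac_eq_eq mult.commute del: binomial_Suc_Suc of_nat_Suc)
        moreover have "of_nat (Suc m choose Suc j) / of_nat (Suc j) - of_nat (m choose Suc j) / of_nat (Suc j)
               = (of_nat (m choose j) / of_nat (Suc j) :: rat)"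
          by (simp add: add_divide_distrib del: of_nat_Suc)
        ultimately show ?thesis unfolding Suc
          by (cases "odd (Suc j)") (simp_all only: if_True if_False simp_thms diff_self)
      qed simp
    qed
    also have "\<dots> = (\<Sum>i\<le>Suc m. if odd i then of_nat (Suc m choose i) else 0) / of_nat (Suc m)"
      unfolding sum_divide_distrib by (intro sum.cong) auto
    \<comment> \<open>Half of all subsets of a nonempty set have odd size.\<close>
    also have "(\<Sum>i\<le>Suc m. if odd i then of_nat (Suc m choose i) else 0) = (2 ^ m :: rat)"
      using choose_odd_sum[of "Suc m", where ?'a = rat] by simp
    finally show ?thesis .
  qed
  hence g: "g (Suc (Suc n)) = 2 ^ Suc n / of_nat (Suc (Suc n)) + g (Suc n)" by (simp add: algebra_simps)
  have IH: "2 ^ n * inv_binomial_sum n = of_nat (Suc n) * g (Suc n)"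
    using Suc.IH unfolding g_def .
  have "2 ^ Suc n * inv_binomial_sum (Suc n) = 2 ^ n * (2 * inv_binomial_sum (Suc n))" by simp
  also have "\<dots> = 2 ^ Suc n + of_nat (n + 2) / of_nat (n + 1) * (2 ^ n * inv_binomial_sum n)"
    unfolding inv_binomial_sum_Suc by (simp add: algebra_simps)
  also have "\<dots> = 2 ^ Suc n + of_nat (Suc (Suc n)) * g (Suc n)"
    unfolding IH by (simp add: divide_simps del: of_nat_Suc) 
  also have "\<dots> = of_nat (Suc (Suc n)) * g (Suc (Suc n))"
    unfolding g by (simp add: distrib_left del: of_nat_Suc)
  finally show ?case unfolding g_def .
qed

section \<open>Absolute values at prime powers\<close>

context
  fixes p :: nat
  assumes prime: "prime p"
begin

section \<open>Rules for the ultrametric absolute value\<close>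

lemma padic_abs_1 [simp]: "padic_abs p 1 = 1"
proof -
  have "padic_abs p 1 * padic_abs p 1 = padic_abs p 1"
    using padic_abs_mult[OF prime, of 1 1] by simp
  moreover have "padic_abs p 1 \<noteq> 0" using prime by (simp add: padic_abs_eq_0_iff)
  ultimately show ?thesis by simp
qed

lemma padic_abs_power: "padic_abs p (x ^ n) = padic_abs p x ^ n"
  by (induction n) (simp_all add: padic_abs_mult prime)

lemma padic_abs_divide: "padic_abs p (x / y) = padic_abs p x / padic_abs p y"
proof (cases "y = 0")
  case False
  have "padic_abs p (x / y) * padic_abs p y = padic_abs p x"
    using False by (simp add: padic_abs_mult[OF prime, symmetric])
  moreover have "padic_abs p y \<noteq> 0" using False prime by (simp add: padic_abs_eq_0_iff)
  ultimately show ?thesis by (simp add: field_simps)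
qed simp

lemma padic_abs_diff_le: "padic_abs p (x - y) \<le> max (padic_abs p x) (padic_abs p y)"
  using padic_abs_add_le[OF prime, of x "- y"] by (simp add: padic_abs_minus)

text \<open>Writing \<open>x = (x + y) - y\<close> bounds |x| by the maximum of |x + y| and |y|,
  which cannot be |y|.\<close>

lemma padic_abs_add_eq_left:
  assumes "padic_abs p y < padic_abs p x"
  shows "padic_abs p (x + y) = padic_abs p x"
  using padic_abs_add_le[OF prime, of x y] padic_abs_diff_le[of "x + y" y] assms by auto

lemma padic_abs_diff_eq_left:
  assumes "padic_abs p y < padic_abs p x"
  shows "padic_abs p (x - y) = padic_abs p x"
  using padic_abs_add_eq_left[of "- y" x] assms by (simp add: padic_abs_minus)

lemma padic_abs_sum_le:
  assumes "\<And>i. i \<in> A \<Longrightarrow> padic_abs p (f i) \<le> B" "0 \<le> B"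
  shows "padic_abs p (sum f A) \<le> B"
  using assms(1)
proof (induction A rule: infinite_finite_induct)
  case (insert x A)
  thus ?case using padic_abs_add_le[OF prime, of "f x" "sum f A"] by fastforce
qed (use assms(2) in auto)

lemma padic_abs_of_int_less_1_iff: "padic_abs p (of_int a) < 1 \<longleftrightarrow> int p dvd a"
  using padic_abs_of_int_less_iff[OF prime, of a 0] by simp

lemma padic_abs_of_int_le_1: "padic_abs p (of_int a) \<le> 1"
proof (cases "a = 0")
  case False
  have "padic_val p (of_int a) \<ge> 0" using padic_val_divide[OF prime False, of 1] by simp
  thus ?thesis using False prime_gt_1_nat[OF prime]
    by (simp add: padic_abs_def power_int_minus power_int_def field_simps)
qed simp

lemma padic_abs_of_nat_less_iff: "padic_abs p (of_nat n) < 1 / real p ^ m \<longleftrightarrow> p ^ Suc m dvd n"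
  using padic_abs_of_int_less_iff[OF prime, of "int n" m]
  by (simp only: of_int_of_nat_eq of_nat_power[symmetric] of_nat_dvd_iff)

lemma padic_abs_of_nat_less_1_iff: "padic_abs p (of_nat n) < 1 \<longleftrightarrow> p dvd n"
  using padic_abs_of_nat_less_iff[of n 0] by simp

lemma padic_abs_of_nat_le_1: "padic_abs p (of_nat n) \<le> 1"
  using padic_abs_of_int_le_1[of "int n"] by simp

lemma padic_abs_of_nat_eq_1_iff: "padic_abs p (of_nat n) = 1 \<longleftrightarrow> \<not> p dvd n"
  using padic_abs_of_nat_le_1[of n] by (auto simp: padic_abs_of_nat_less_1_iff[symmetric])

lemma padic_abs_of_nat_pos: 
  assumes "n > 0"
  shows "padic_abs p (of_nat n) > 0"
proof -
  have "padic_abs p (of_nat n) \<noteq> 0" using assms prime by (simp add: padic_abs_eq_0_iff)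
  thus ?thesis using padic_abs_nonneg[of p "of_nat n"] by linarith
qed

section \<open>Numbers and binomial coefficients below a prime power\<close>

lemma padic_abs_of_nat_prime: "padic_abs p (of_nat p) = 1 / real p"
proof -
  have "padic_val p (of_nat p) = 1"
    using padic_val_divide[OF prime, of "int p" 1] prime prime_gt_0_nat[OF prime]
    by (simp add: multiplicity_self prime_gt_1_nat)
  thus ?thesis using prime_gt_0_nat[OF prime]
    by (simp add: padic_abs_def power_int_minus divide_inverse)
qed

lemma padic_abs_of_nat_prime_power: "padic_abs p (of_nat (p ^ m)) = 1 / real p ^ m"
  by (simp add: padic_abs_power padic_abs_of_nat_prime power_one_over)

text \<open>As \<open>p ^ m\<close> does not divide \<open>i\<close>, at least one factor
  \<open>p\<close> survives in the quotient.\<close>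

lemma padic_abs_prime_power_divide_le:
  assumes "0 < i" "i < p ^ m"
  shows "padic_abs p (of_nat (p ^ m) / of_nat i) \<le> 1 / real p"
proof -
  obtain l where m: "m = Suc l" using assms by (cases m) auto
  have "\<not> p ^ Suc l dvd i" using assms by (auto simp: m dest: dvd_imp_le)
  hence le: "1 / real p ^ l \<le> padic_abs p (of_nat i)"
    using padic_abs_of_nat_less_iff[of i l] by linarith
  have "1 / real p ^ m = (1 / real p) * (1 / real p ^ l)" by (simp add: m)
  also have "\<dots> \<le> (1 / real p) * padic_abs p (of_nat i)"
    using le by (intro mult_left_mono) auto
  finally show ?thesis
    unfolding padic_abs_divide padic_abs_of_nat_prime_power
    by (simp only: pos_divide_le_eq[OF padic_abs_of_nat_pos[OF assms(1)]])
qed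

lemma padic_abs_prime_power_diff:
  assumes "0 < i" "i < p ^ m"
  shows "padic_abs p (of_nat (p ^ m - i)) = padic_abs p (of_nat i)"
proof -
  have "1 / real p < 1" using prime_gt_1_nat[OF prime] by simp
  with padic_abs_prime_power_divide_le[OF assms]
  have "padic_abs p (of_nat (p ^ m) / of_nat i) < 1" by (rule order_le_less_trans)
  hence "padic_abs p (of_nat (p ^ m)) < padic_abs p (of_nat i)"
    unfolding padic_abs_divide by (simp only: pos_divide_less_eq[OF padic_abs_of_nat_pos[OF assms(1)]] mult_1)
  from padic_abs_diff_eq_left[OF this]
  have "padic_abs p (of_nat i - of_nat (p ^ m)) = padic_abs p (of_nat i)" .
  moreover have "of_nat (p ^ m - i) = (of_nat (p ^ m) - of_nat i :: rat)"
    using assms by (intro of_nat_diff) simp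
  ultimately show ?thesis by (simp only: padic_abs_minus_commute)
qed

text \<open>The congruence of \<open>(p ^ m - 1) choose j\<close> with \<open>(- 1) ^ j\<close>
  modulo \<open>p\<close>. By Pascal's rule consecutive coefficients add up to
  \<open>p ^ m choose Suc j\<close>, a multiple of \<open>p\<close>.\<close>

lemma padic_abs_choose_prime_power_minus_one:
  assumes "j < p ^ m"
  shows "padic_abs p (of_nat ((p ^ m - 1) choose j) - (- 1) ^ j) < 1"
  using assms
proof (induction j)
  case (Suc j)
  let ?N = "p ^ m"
  have "Suc j * (?N choose Suc j) = ?N * ((?N - 1) choose j)"
    by (rule binomial_absorption)
  hence "of_nat (Suc j) * of_nat (?N choose Suc j) = (of_nat ?N * of_nat ((?N - 1) choose j) :: rat)"
    by (simp only: of_nat_mult[symmetric])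
  hence "of_nat (?N choose Suc j)
         = (of_nat ?N / of_nat (Suc j) * of_nat ((?N - 1) choose j) :: rat)"
    by (simp add: field_simps del: of_nat_Suc of_nat_power binomial_Suc_Suc)
  hence "padic_abs p (of_nat (?N choose Suc j))
         = padic_abs p (of_nat ?N / of_nat (Suc j)) * padic_abs p (of_nat ((?N - 1) choose j))"
    by (simp only: padic_abs_mult[OF prime])
  also have "\<dots> \<le> 1 / real p * 1"
    using Suc.prems by (intro mult_mono padic_abs_prime_power_divide_le padic_abs_of_nat_le_1) auto
  also have "\<dots> < 1" using prime_gt_1_nat[OF prime] by simp
  finally have small: "padic_abs p (of_nat (?N choose Suc j)) < 1" .
  have "?N choose Suc j = ((?N - 1) choose j) + ((?N - 1) choose Suc j)"
    using Suc.prems choose_reduce_nat[of ?N "Suc j"] prime_gt_0_nat[OF prime] by simp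
  hence "of_nat ((?N - 1) choose Suc j) - (- 1) ^ Suc j
         = of_nat (?N choose Suc j) - (of_nat ((?N - 1) choose j) - (- 1) ^ j :: rat)"
    by simp
  moreover have "padic_abs p (of_nat ((?N - 1) choose j) - (- 1) ^ j) < 1"
    using Suc by simp
  ultimately show ?case
    using small padic_abs_diff_le[of "of_nat (?N choose Suc j)" "of_nat ((?N - 1) choose j) - (- 1) ^ j"]
    by (simp only: max_less_iff_conj)
qed simp

text \<open>Absolute values of integers are discrete: one below 1 is already at most
  \<open>1 / p\<close>.\<close>

lemma padic_abs_of_int_le_inverse_prime:
  assumes "int p dvd a"
  shows "padic_abs p (of_int a) \<le> 1 / real p"
proof -
  obtain c where a: "a = int p * c" using assms by (rule dvdE)
  have "padic_abs p (of_int a) = padic_abs p (of_nat p) * padic_abs p (of_int c)"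
    by (simp add: a padic_abs_mult[OF prime])
  also have "\<dots> \<le> padic_abs p (of_nat p) * 1"
    by (intro mult_left_mono padic_abs_of_int_le_1) simp
  finally show ?thesis by (simp add: padic_abs_of_nat_prime)
qed

section \<open>Sums of squares \<open>(N / i)^2\<close> modulo \<open>p ^ 3\<close>\<close>

lemma padic_abs_sum_prime_power_reflect:
  assumes "I \<subseteq> {1..<p ^ m}"
  shows "padic_abs p ((\<Sum>i\<in>I. (of_nat (p ^ m) / of_nat (p ^ m - i))\<^sup>2)
                      - (\<Sum>i\<in>I. (of_nat (p ^ m) / of_nat i)\<^sup>2)) \<le> 1 / real p ^ 3"
  unfolding sum_subtractf[symmetric]
proof (rule padic_abs_sum_le)
  fix i assume "i \<in> I"
  hence i: "0 < i" "i < p ^ m" using assms by auto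
  define N a b :: rat where "N = of_nat (p ^ m)" and "a = of_nat i" and "b = of_nat (p ^ m - i)"
  have nz: "a > 0" "b > 0" using i by (simp_all add: a_def b_def)
  have ab: "a + b = N" using i by (simp add: a_def b_def N_def of_nat_diff)
  \<comment> \<open>Two factors \<open>N\<close> are visible; the third is \<open>a + b\<close>,
    split off from the difference of the squares of \<open>a\<close> and \<open>b\<close>. This is
    why the error has order \<open>p ^ 3\<close> and not \<open>p ^ 2\<close>.\<close>
  have "(N / b)\<^sup>2 - (N / a)\<^sup>2 = (N * a / (a * b))\<^sup>2 - (N * b / (a * b))\<^sup>2"
    using nz by simp
  also have "\<dots> = ((N * a)\<^sup>2 - (N * b)\<^sup>2) / (a * b)\<^sup>2"
    by (simp only: power_divide diff_divide_distrib)
  also have "(N * a)\<^sup>2 - (N * b)\<^sup>2 = N\<^sup>2 * (a + b) * (a - b)"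
    by (simp add: power2_eq_square algebra_simps)
  also have "N\<^sup>2 * (a + b) * (a - b) / (a * b)\<^sup>2 = (N / b) * (N / b) * (N / a) * ((a - b) / a)"
    unfolding ab using nz by (simp add: power2_eq_square)
  finally have eq: "(N / b)\<^sup>2 - (N / a)\<^sup>2 = (N / b) * (N / b) * (N / a) * ((a - b) / a)" .
  have abs_b: "padic_abs p b = padic_abs p a"
    unfolding a_def b_def by (rule padic_abs_prime_power_diff) (use i in auto)
  have Na: "padic_abs p (N / a) \<le> 1 / real p"
    unfolding N_def a_def by (rule padic_abs_prime_power_divide_le) (use i in auto)
  hence Nb: "padic_abs p (N / b) \<le> 1 / real p" by (simp only: padic_abs_divide abs_b)
  have "padic_abs p (a - b) \<le> padic_abs p a"
    using padic_abs_diff_le[of a b] by (simp add: abs_b)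
  moreover have "padic_abs p a > 0" unfolding a_def by (rule padic_abs_of_nat_pos) (use i in auto)
  ultimately have ab1: "padic_abs p ((a - b) / a) \<le> 1"
    unfolding padic_abs_divide by simp
  have "padic_abs p ((N / b)\<^sup>2 - (N / a)\<^sup>2)
        = padic_abs p (N / b) * padic_abs p (N / b) * padic_abs p (N / a) * padic_abs p ((a - b) / a)"
    unfolding eq by (simp only: padic_abs_mult[OF prime])
  also have "\<dots> \<le> (1 / real p) * (1 / real p) * (1 / real p) * 1"
    by (intro mult_mono Na Nb ab1) auto
  also have "\<dots> = 1 / real p ^ 3" by (simp add: power3_eq_cube)
  finally show "padic_abs p ((of_nat (p ^ m) / of_nat (p ^ m - i))\<^sup>2 - (of_nat (p ^ m) / of_nat i)\<^sup>2)
                \<le> 1 / real p ^ 3"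
    unfolding N_def a_def b_def .
qed simp

text \<open>
  Write \<open>S\<close> for the sum over the odd \<open>i\<close> and \<open>T\<close> for the sum over the even ones, \<open>A\<close> for the sum over
  \<open>i < N / 2\<close> and \<open>B\<close> for the rest. Modulo \<open>p ^ 3\<close>, reflection gives \<open>S = T\<close> and \<open>A = B\<close>, and
  doubling \<open>i\<close> gives \<open>T = A / 4\<close>. Hence \<open>A / 2 = 2 A\<close>, so \<open>A\<close> and \<open>S\<close> vanish as \<open>p > 3\<close>.
\<close>
lemma padic_abs_odd_inverse_squares:
  assumes "p > 3"
  shows "padic_abs p (\<Sum>i | i < p ^ m \<and> odd i. (of_nat (p ^ m) / of_nat i)\<^sup>2) \<le> 1 / real p ^ 3"
proof -
  define N where "N = p ^ m"
  define q :: "nat \<Rightarrow> rat" where "q i = (of_nat N / of_nat i)\<^sup>2" for i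
  define E where "E = {i. 0 < i \<and> i < N \<and> even i}"
  define O' where "O' = {i. i < N \<and> odd i}"
  define H where "H = {i. 0 < i \<and> 2 * i < N}"
  define U where "U = {i. i < N \<and> N < 2 * i}"
  have "odd p" using prime assms prime_odd_nat by simp
  hence N: "odd N" by (simp add: N_def)
  have fin: "finite E" "finite O'" "finite H" "finite U"
    by (auto simp: E_def O'_def H_def U_def intro: finite_subset[of _ "{..<N}"])
  have sub: "E \<subseteq> {1..<p ^ m}" "H \<subseteq> {1..<p ^ m}"
    by (auto simp: E_def H_def N_def[symmetric])
  \<comment> \<open>The exact errors \<open>e\<close> and \<open>h\<close> of the two reflections
    turn the congruences into equations.\<close>
  define e where "e = (\<Sum>i\<in>E. q (N - i)) - sum q E"
  define h where "h = (\<Sum>i\<in>H. q (N - i)) - sum q H"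
  have eh: "padic_abs p e \<le> 1 / real p ^ 3" "padic_abs p h \<le> 1 / real p ^ 3"
    using padic_abs_sum_prime_power_reflect[OF sub(1)] padic_abs_sum_prime_power_reflect[OF sub(2)]
    unfolding e_def h_def q_def N_def by auto
  \<comment> \<open>Since \<open>N\<close> is odd, reflection exchanges even and odd
    indices.\<close>
  have "sum q O' = (\<Sum>i\<in>E. q (N - i))"
    by (rule sum.reindex_bij_witness[of _ "\<lambda>i. N - i" "\<lambda>i. N - i"])
       (use N in \<open>auto simp: E_def O'_def elim: oddE\<close>)
  hence O': "sum q O' = sum q E + e" by (simp add: e_def)
  have "sum q U = (\<Sum>i\<in>H. q (N - i))"
    by (rule sum.reindex_bij_witness[of _ "\<lambda>i. N - i" "\<lambda>i. N - i"]) (auto simp: H_def U_def)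
  hence U: "sum q U = sum q H + h" by (simp add: h_def)
  have "sum q E = (\<Sum>i\<in>H. q (2 * i))"
    by (rule sum.reindex_bij_witness[of _ "\<lambda>i. 2 * i" "\<lambda>i. i div 2"]) (auto simp: E_def H_def)
  also have "\<dots> = (\<Sum>i\<in>H. q i / 4)"
    by (intro sum.cong refl) (simp add: q_def power_divide power_mult_distrib)
  finally have E: "sum q E = sum q H / 4" by (simp add: sum_divide_distrib)
  have "2 * i \<noteq> N" for i using N by auto
  hence "H \<union> U = {0<..<N}" by (auto simp: H_def U_def) (metis linorder_neqE_nat)
  moreover have "E \<union> O' = {0<..<N}" by (auto simp: E_def O'_def intro: odd_pos)
  ultimately have "E \<union> O' = H \<union> U" by (rule trans[OF _ sym, rotated])
  moreover have "E \<inter> O' = {}" "H \<inter> U = {}"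
    by (auto simp: E_def O'_def H_def U_def)
  ultimately have "sum q E + sum q O' = sum q H + sum q U"
    using fin by (metis sum.union_disjoint)
  \<comment> \<open>The equation reads \<open>sum q H / 2 + e = 2 * sum q H + h\<close>.\<close>
  hence H: "sum q H = (e - h) * 2 / 3" unfolding O' U E by simp
  \<comment> \<open>The odd sum is found by dividing by 6, a unit because
    \<open>p > 3\<close>.\<close>
  have e1: "padic_abs p (of_nat 2) = 1" "padic_abs p (of_nat 3) = 1"
    unfolding padic_abs_of_nat_eq_1_iff using assms by (auto dest: dvd_imp_le)
  have "sum q O' = (e - h) / (of_nat 2 * of_nat 3) + e"
    unfolding O' E H by simp
  also have "padic_abs p \<dots> \<le> max (padic_abs p ((e - h) / (of_nat 2 * of_nat 3))) (padic_abs p e)"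
    by (rule padic_abs_add_le[OF prime])
  also have "padic_abs p ((e - h) / (of_nat 2 * of_nat 3)) = padic_abs p (e - h)"
    unfolding padic_abs_divide padic_abs_mult[OF prime] e1 by simp
  also have "max (padic_abs p (e - h)) (padic_abs p e) \<le> 1 / real p ^ 3"
    using padic_abs_diff_le[of e h] eh by linarith
  finally show ?thesis unfolding q_def O'_def N_def .
qed

text \<open>Here \<open>p ^ m - 1 = (p - 1) * c\<close> with \<open>c\<close> the geometric sum,
  congruent to 1 modulo \<open>p\<close>. For \<open>a = 2 ^ (p - 1)\<close>, also congruent to 1,
  the cofactor of \<open>a - 1\<close> in \<open>a ^ c - 1\<close> is congruent to \<open>c\<close>,
  hence a unit.\<close>

lemma padic_abs_two_power_minus_one:
  assumes "odd p" "m > 0"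
  shows "padic_abs p (2 ^ (p ^ m - 1) - 1) = padic_abs p (2 ^ (p - 1) - 1)"
proof -
  define a :: int where "a = 2 ^ (p - 1)"
  define c where "c = (\<Sum>i<m. p ^ i)"
  have p: "p > 1" using prime prime_gt_1_nat by blast
  have "int (p ^ m - 1) = int p ^ m - 1" using p by (simp add: of_nat_diff)
  also have "\<dots> = (int p - 1) * (\<Sum>i<m. int p ^ i)" by (rule power_diff_1_eq)
  also have "\<dots> = int ((p - 1) * c)" using p by (simp add: c_def of_nat_diff)
  finally have exp: "p ^ m - 1 = (p - 1) * c" by (simp only: of_nat_eq_iff)
  have "\<not> p dvd 2" using assms(1) prime by (metis primes_dvd_imp_eq two_is_prime_nat even_numeral)
  hence "[2 ^ (p - 1) = 1] (mod p)" by (intro fermat_theorem prime)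
  hence a: "int p dvd a - 1"
    unfolding a_def cong_def by (metis mod_eq_dvd_iff of_nat_1 of_nat_mod of_nat_numeral of_nat_power)
  have "a mod int p = 1 mod int p" using a by (simp add: mod_eq_dvd_iff)
  hence "a ^ i mod int p = 1 mod int p" for i by (metis power_mod power_one)
  hence "int p dvd (a ^ i - 1)" for i by (simp add: mod_eq_dvd_iff)
  hence "int p dvd (\<Sum>i<c. a ^ i - 1)" by (intro dvd_sum) auto
  hence 1: "int p dvd (\<Sum>i<c. a ^ i) - int c" by (simp add: sum_subtractf)
  have "\<not> p dvd c"
  proof
    assume "p dvd c"
    moreover have "c = 1 + p * (\<Sum>i<m - 1. p ^ i)"
      using assms(2) unfolding c_def by (cases m) (simp_all add: sum.lessThan_Suc_shift sum_distrib_left del: sum.lessThan_Suc)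
    ultimately have "p dvd 1" by (metis dvd_add_left_iff dvd_triv_left)
    thus False using p by simp
  qed
  hence "\<not> int p dvd (\<Sum>i<c. a ^ i)" using 1 by (metis dvd_diff_commute dvd_diffD1 int_dvd_int_iff zdvd_zdiffD)
  hence unit: "padic_abs p (of_int (\<Sum>i<c. a ^ i)) = 1"
    using padic_abs_of_int_le_1[of "\<Sum>i<c. a ^ i"] padic_abs_of_int_less_1_iff[of "\<Sum>i<c. a ^ i"]
    by linarith
  have "(2 :: rat) ^ (p ^ m - 1) = (2 ^ (p - 1)) ^ c" by (simp only: exp power_mult)
  hence "(2 ^ (p ^ m - 1) - 1 :: rat) = of_int (a ^ c - 1)" by (simp add: a_def)
  also have "a ^ c - 1 = (a - 1) * (\<Sum>i<c. a ^ i)" by (rule power_diff_1_eq)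
  finally have "padic_abs p (2 ^ (p ^ m - 1) - 1) = padic_abs p (of_int (a - 1))"
    by (simp only: of_int_mult padic_abs_mult[OF prime] unit mult_1_right)
  thus ?thesis by (simp add: a_def)
qed

section \<open>Divergence\<close>

lemma inv_binomial_sum_prime_power:
  assumes "odd p"
  shows "2 ^ (p ^ m - 1) * inv_binomial_sum (p ^ m - 1)
         = 1 + (\<Sum>i | i < p ^ m \<and> odd i. (of_nat (p ^ m) / of_nat i)\<^sup>2 * of_nat ((p ^ m - 1) choose (i - 1)))"
proof -
  define N where "N = p ^ m"
  have N: "odd N" "N > 0" using assms prime_gt_0_nat[OF prime] by (simp_all add: N_def)
  let ?t = "\<lambda>i. (of_nat N / of_nat i)\<^sup>2 * of_nat ((N - 1) choose (i - 1)) :: rat"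
  have "2 ^ (N - 1) * inv_binomial_sum (N - 1)
        = (\<Sum>i\<le>N. of_nat N * (if odd i then of_nat (N choose i) / of_nat i else 0))"
    using inv_binomial_sum_eq[of "N - 1"] unfolding Suc_diff_1[OF N(2)] by (simp only: sum_distrib_left)
  also have "\<dots> = (\<Sum>i\<le>N. if odd i then ?t i else 0)"
  proof (intro sum.cong refl)
    fix i
    show "of_nat N * (if odd i then of_nat (N choose i) / of_nat i else 0) = (if odd i then ?t i else 0)"
    proof (cases "odd i")
      case True
      hence i: "i > 0" by (rule odd_pos)
      have "of_nat i * of_nat (N choose i) = (of_nat N * of_nat ((N - 1) choose (i - 1)) :: rat)"
        by (simp only: of_nat_mult[symmetric] times_binomial_minus1_eq[OF i])
      hence "of_nat (N choose i) = (of_nat N * of_nat ((N - 1) choose (i - 1)) / of_nat i :: rat)"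
        using i by (simp add: field_simps)
      thus ?thesis using True by (simp add: power2_eq_square)
    qed simp
  qed
  \<comment> \<open>The term \<open>i = N\<close> is present because \<open>N\<close> is odd, and it
    equals 1.\<close>
  also have "\<dots> = 1 + (\<Sum>i<N. if odd i then ?t i else 0)"
    using N unfolding lessThan_Suc_atMost[symmetric] sum.lessThan_Suc by simp
  also have "(\<Sum>i<N. if odd i then ?t i else 0) = (\<Sum>i | i < N \<and> odd i. ?t i)"
    by (rule sum.mono_neutral_cong_right) auto
  finally show ?thesis unfolding N_def .
qed

text \<open>With \<open>z = 2 ^ (p ^ m - 1)\<close>, a unit,
  \<open>z * (inv_binomial_sum (p ^ m - 1) - 1) = y - (z - 1)\<close>. So it suffices that |y| is
  smaller than |z - 1|, which is \<open>w\<close>.\<close>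

lemma padic_abs_inv_binomial_sum_minus_one:
  assumes odd: "odd p" and nw: "\<not> int p ^ 2 dvd 2 ^ (p - 1) - 1 \<or> \<not> int p ^ 3 dvd 2 ^ (p - 1) - 1 \<and> p > 3"
    and m: "m > 0"
  shows "padic_abs p (inv_binomial_sum (p ^ m - 1) - 1) = padic_abs p (2 ^ (p - 1) - 1)"
proof -
  define O' where "O' = {i. i < p ^ m \<and> odd i}"
  define q :: "nat \<Rightarrow> rat" where "q i = (of_nat (p ^ m) / of_nat i)\<^sup>2" for i
  define C :: "nat \<Rightarrow> rat" where "C i = of_nat ((p ^ m - 1) choose (i - 1))" for i
  define y where "y = (\<Sum>i\<in>O'. q i * C i)"
  define z :: rat where "z = 2 ^ (p ^ m - 1)"
  define w where "w = padic_abs p (2 ^ (p - 1) - 1)"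
  have p1: "real p > 1" using prime_gt_1_nat[OF prime] by simp
  have eq: "z * inv_binomial_sum (p ^ m - 1) = 1 + y"
    unfolding z_def y_def q_def C_def O'_def by (rule inv_binomial_sum_prime_power[OF odd])
  have w_iff: "w < 1 / real p ^ r \<longleftrightarrow> int p ^ Suc r dvd 2 ^ (p - 1) - 1" for r
    using padic_abs_of_int_less_iff[OF prime, of "2 ^ (p - 1) - 1" r] by (simp add: w_def)
  have q: "padic_abs p (q i) \<le> 1 / real p ^ 2" if "i \<in> O'" for i
  proof -
    have i: "0 < i" "i < p ^ m" using that by (auto simp: O'_def intro: odd_pos)
    show ?thesis
      unfolding q_def padic_abs_power power_one_over[symmetric]
      by (intro power_mono padic_abs_prime_power_divide_le i) auto
  qed
  have zw: "padic_abs p (z - 1) = w"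
    unfolding z_def w_def by (rule padic_abs_two_power_minus_one[OF odd m])
  have less: "padic_abs p y < w"
  \<comment> \<open>If \<open>w\<close> is at least \<open>1 / p\<close>, the squares in
    \<open>y\<close> suffice. Otherwise \<open>w\<close> is at least \<open>1 / p ^ 2\<close> and
    one more factor \<open>p\<close> is needed.\<close>
  proof (cases "int p ^ 2 dvd 2 ^ (p - 1) - 1")
    case False
    hence "1 / real p ^ 1 \<le> w" using w_iff[of 1] by (simp add: numeral_2_eq_2)
    moreover have "padic_abs p (q i * C i) \<le> 1 / real p ^ 2" if "i \<in> O'" for i
      using mult_mono[OF q[OF that] padic_abs_of_nat_le_1[of "(p ^ m - 1) choose (i - 1)"]]
      by (simp add: padic_abs_mult[OF prime] C_def)
    hence "padic_abs p y \<le> 1 / real p ^ 2" unfolding y_def by (rule padic_abs_sum_le) auto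
    moreover have "1 / real p ^ 2 < 1 / real p ^ 1"
      using p1 by (intro divide_strict_left_mono power_strict_increasing) auto
    ultimately show ?thesis by linarith
  next
    case True
    hence p3: "p > 3" and "\<not> int p ^ 3 dvd 2 ^ (p - 1) - 1" using nw by auto
    hence w: "1 / real p ^ 2 \<le> w" using w_iff[of 2] by (simp add: numeral_3_eq_3)
    \<comment> \<open>As \<open>i - 1\<close> is even, \<open>C i\<close> is congruent to 1;
      replacing it by 1 costs only a multiple of \<open>p ^ 3\<close> and leaves the pure sum of
      squares.\<close>
    have "padic_abs p (q i * (C i - 1)) \<le> 1 / real p ^ 3" if "i \<in> O'" for i
    proof -
      have "padic_abs p (of_nat ((p ^ m - 1) choose (i - 1)) - (- 1) ^ (i - 1)) < 1"
        by (rule padic_abs_choose_prime_power_minus_one) (use that in \<open>auto simp: O'_def\<close>)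
      moreover have "even (i - 1)" using that by (auto simp: O'_def)
      ultimately have "padic_abs p (of_int (int ((p ^ m - 1) choose (i - 1)) - 1)) < 1" by simp
      hence "padic_abs p (of_int (int ((p ^ m - 1) choose (i - 1)) - 1)) \<le> 1 / real p"
        by (simp only: padic_abs_of_int_less_1_iff padic_abs_of_int_le_inverse_prime)
      hence "padic_abs p (C i - 1) \<le> 1 / real p" by (simp add: C_def)
      hence "padic_abs p (q i * (C i - 1)) \<le> 1 / real p ^ 2 * (1 / real p)"
        unfolding padic_abs_mult[OF prime] by (intro mult_mono q that) auto
      thus ?thesis by (simp add: power3_eq_cube power2_eq_square)
    qed
    hence "padic_abs p (\<Sum>i\<in>O'. q i * (C i - 1)) \<le> 1 / real p ^ 3"
      by (rule padic_abs_sum_le) auto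
    moreover have "padic_abs p (sum q O') \<le> 1 / real p ^ 3"
      using padic_abs_odd_inverse_squares[OF p3, of m] unfolding q_def O'_def .
    moreover have "y = (\<Sum>i\<in>O'. q i * (C i - 1)) + sum q O'"
      by (simp add: y_def sum.distrib[symmetric] algebra_simps)
    ultimately have "padic_abs p y \<le> 1 / real p ^ 3"
      using padic_abs_add_le[OF prime, of "\<Sum>i\<in>O'. q i * (C i - 1)" "sum q O'"] by simp
    moreover have "1 / real p ^ 3 < 1 / real p ^ 2"
      using p1 by (intro divide_strict_left_mono power_strict_increasing) auto
    ultimately show ?thesis using w by linarith
  qed
  have "\<not> p dvd 2" using odd prime by (metis primes_dvd_imp_eq two_is_prime_nat even_numeral)
  hence "padic_abs p 2 = 1" using padic_abs_of_nat_eq_1_iff[of 2] by simp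
  hence "padic_abs p z = 1" by (simp add: z_def padic_abs_power)
  hence "padic_abs p (inv_binomial_sum (p ^ m - 1) - 1)
         = padic_abs p (z * (inv_binomial_sum (p ^ m - 1) - 1))"
    by (simp add: padic_abs_mult[OF prime])
  also have "z * (inv_binomial_sum (p ^ m - 1) - 1) = y - (z - 1)"
    using eq by (simp add: algebra_simps)
  also have "padic_abs p \<dots> = padic_abs p (z - 1 - y)" by (rule padic_abs_minus_commute)
  also have "\<dots> = padic_abs p (z - 1)" by (rule padic_abs_diff_eq_left) (simp only: zw less)
  finally show ?thesis by (simp only: zw w_def)
qed

lemma padic_abs_inv_binomial_sum_even_prime:
  assumes "p = 2" and m: "m > 0"
  shows "padic_abs p (inv_binomial_sum (p ^ m - 1) - 1) = 1"
proof -
  define c :: "nat \<Rightarrow> nat" where "c j = (p ^ m - 1) choose j" for j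
  have c: "padic_abs p (inverse (of_nat (c j)) - 1) \<le> 1 / real p" if "j \<in> {..p ^ m - 1}" for j
  proof -
    have "j < p ^ m" using that prime_gt_0_nat[OF prime] by (simp add: Suc_le_eq[symmetric] le_diff_conv2)
    from padic_abs_choose_prime_power_minus_one[OF this]
    have "padic_abs p (of_int (int (c j) - (- 1) ^ j)) < 1" by (simp add: c_def)
    hence "even (int (c j) - (- 1) ^ j)"
      unfolding padic_abs_of_int_less_1_iff using \<open>p = 2\<close> by simp
    hence odd: "odd (c j)" by simp
    hence c1: "padic_abs p (of_nat (c j)) = 1"
      unfolding padic_abs_of_nat_eq_1_iff using \<open>p = 2\<close> by simp
    have nz: "c j \<noteq> 0" using odd by (intro notI) simp
    have "padic_abs p (of_int (1 - int (c j))) \<le> 1 / real p"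
      by (rule padic_abs_of_int_le_inverse_prime) (use odd \<open>p = 2\<close> in simp)
    moreover have "inverse (of_nat (c j)) - 1 = (of_int (1 - int (c j)) / of_nat (c j) :: rat)"
      using nz by (simp add: field_simps)
    ultimately show ?thesis by (simp only: padic_abs_divide c1 div_by_1)
  qed
  have N: "p ^ m > 0" using prime_gt_0_nat[OF prime] by simp
  \<comment> \<open>Each inverse of an odd coefficient is congruent to 1 modulo 2, so the sum is
    congruent to the number \<open>p ^ m\<close> of its terms.\<close>
  have "padic_abs p (\<Sum>j\<le>p ^ m - 1. inverse (of_nat (c j)) - 1) \<le> 1 / real p"
    by (rule padic_abs_sum_le[OF c]) auto
  also have "(\<Sum>j\<le>p ^ m - 1. inverse (of_nat (c j)) - 1) = inv_binomial_sum (p ^ m - 1) - of_nat (p ^ m)"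
    using N by (simp add: inv_binomial_sum_def c_def sum_subtractf)
  finally have 1: "padic_abs p (inv_binomial_sum (p ^ m - 1) - of_nat (p ^ m)) \<le> 1 / real p" .
  have "p dvd p ^ m" using m by simp
  hence 2: "padic_abs p (of_nat (p ^ m)) < 1" by (simp only: padic_abs_of_nat_less_1_iff)
  have "1 / real p < 1" using prime_gt_1_nat[OF prime] by simp
  hence "padic_abs p (inv_binomial_sum (p ^ m - 1)) < 1"
    using padic_abs_add_le[OF prime, of "inv_binomial_sum (p ^ m - 1) - of_nat (p ^ m)" "of_nat (p ^ m)"] 1 2
    by simp
  hence "padic_abs p (1 - inv_binomial_sum (p ^ m - 1)) = 1"
    using padic_abs_diff_eq_left[of "inv_binomial_sum (p ^ m - 1)" 1] by simp
  thus ?thesis by (simp only: padic_abs_minus_commute)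
qed

text \<open>The recurrence solved for its lower term. Division by |n + 2| produces the growth when
  \<open>n + 2 = p ^ m\<close>.\<close>

lemma padic_abs_inv_binomial_sum_pred:
  "padic_abs p (inv_binomial_sum n)
   = padic_abs p 2 * padic_abs p (of_nat (n + 1)) / padic_abs p (of_nat (n + 2))
     * padic_abs p (inv_binomial_sum (Suc n) - 1)"
proof -
  have nz: "(of_nat (n + 1) :: rat) \<noteq> 0" "(of_nat (n + 2) :: rat) \<noteq> 0"
    unfolding of_nat_eq_0_iff by simp_all
  have "of_nat (n + 2) / of_nat (n + 1) * inv_binomial_sum n = 2 * (inv_binomial_sum (Suc n) - 1)"
    using inv_binomial_sum_Suc[of n] by (simp add: algebra_simps)
  hence "inv_binomial_sum n
         = 2 * of_nat (n + 1) / of_nat (n + 2) * (inv_binomial_sum (Suc n) - 1)"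
    using nz by (simp add: divide_simps del: of_nat_add) (simp add: algebra_simps)
  thus ?thesis by (metis padic_abs_mult[OF prime] padic_abs_divide)
qed

section \<open>Growth for every \<open>k\<close>, and its conflict with convergence\<close>

lemma prime_power_at_top: "filterlim (\<lambda>m. real p ^ m) at_top sequentially"
  using prime_gt_1_nat[OF prime]
  by (intro filterlim_at_infinity_imp_filterlim_at_top filterlim_realpow_sequentially_gt1) auto

lemma padic_abs_inv_binomial_sum_at_top:
  assumes c: "c > 0" "\<And>m. m > 0 \<Longrightarrow> c \<le> padic_abs p (inv_binomial_sum (p ^ m - 1) - 1)"
    and "k > 0"
  shows "filterlim (\<lambda>m. padic_abs p (inv_binomial_sum (p ^ m - k - 1))) at_top sequentially"
  using assms(3)
proof (induction k rule: nat_induct_non_zero)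
  case 1
  have p1: "p > 1" using prime_gt_1_nat[OF prime] .
  have "padic_abs p 2 > 0" using padic_abs_of_nat_pos[of 2] by simp
  hence pos: "padic_abs p 2 * c > 0" using c(1) by simp
  have "filterlim (\<lambda>m. padic_abs p 2 * c * real p ^ m) at_top sequentially"
    by (rule filterlim_tendsto_pos_mult_at_top[OF tendsto_const pos prime_power_at_top])
  moreover have "eventually (\<lambda>m. padic_abs p 2 * c * real p ^ m
                              \<le> padic_abs p (inv_binomial_sum (p ^ m - 1 - 1))) sequentially"
    using eventually_gt_at_top[of 0]
  proof eventually_elim
    case (elim m)
    have pm: "1 < p ^ m" using p1 elim by (rule one_less_power)
    \<comment> \<open>Here |n + 2| is \<open>1 / p ^ m\<close> and |n + 1| is 1, while
      \<open>c\<close> keeps the last factor away from 0.\<close>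
    define n where "n = p ^ m - 1 - 1"
    have n: "n + 1 = p ^ m - 1" "n + 2 = p ^ m" "Suc n = p ^ m - 1" using pm by (auto simp: n_def)
    have "padic_abs p (inv_binomial_sum n)
          = padic_abs p 2 * real p ^ m * padic_abs p (inv_binomial_sum (p ^ m - 1) - 1)"
      unfolding padic_abs_inv_binomial_sum_pred[of n] n padic_abs_of_nat_prime_power
        padic_abs_prime_power_diff[OF zero_less_one pm] by simp
    moreover have "padic_abs p 2 * real p ^ m * c
                   \<le> padic_abs p 2 * real p ^ m * padic_abs p (inv_binomial_sum (p ^ m - 1) - 1)"
      using c(2)[OF elim] by (intro mult_left_mono) auto
    ultimately show ?case by (simp only: n_def[symmetric] mult_ac)
  qed
  ultimately show ?case by (rule filterlim_at_top_mono)
next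
  case (Suc k)
  \<comment> \<open>Eventually |n + 1| and |n + 2| at \<open>n = p ^ m - Suc k - 1\<close> equal |k
    + 1| and |k|, so the ratio does not depend on \<open>m\<close>.\<close>
  define K where "K = padic_abs p 2 * padic_abs p (of_nat (Suc k)) / padic_abs p (of_nat k)"
  have "padic_abs p 2 > 0" using padic_abs_of_nat_pos[of 2] by simp
  hence K: "K > 0" unfolding K_def using Suc.hyps
    by (intro divide_pos_pos mult_pos_pos padic_abs_of_nat_pos) auto
  have "eventually (\<lambda>m. real (Suc k) < real p ^ m) sequentially"
    using prime_power_at_top by (simp only: filterlim_at_top_dense)
  \<comment> \<open>Above the threshold 1, subtracting 1 does not change the absolute value.\<close>
  moreover have "eventually (\<lambda>m. 1 < padic_abs p (inv_binomial_sum (p ^ m - k - 1))) sequentially"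
    using Suc.IH by (simp only: filterlim_at_top_dense)
  ultimately have "eventually (\<lambda>m. K * padic_abs p (inv_binomial_sum (p ^ m - k - 1))
                              \<le> padic_abs p (inv_binomial_sum (p ^ m - Suc k - 1))) sequentially"
  proof eventually_elim
    case (elim m)
    have pm: "Suc k < p ^ m" using elim(1) by (simp only: of_nat_power[symmetric] of_nat_less_iff)
    define n where "n = p ^ m - Suc k - 1"
    have n: "n + 1 = p ^ m - Suc k" "n + 2 = p ^ m - k" "Suc n = p ^ m - k - 1"
      using pm by (auto simp: n_def)
    have "padic_abs p (inv_binomial_sum (p ^ m - k - 1) - 1) = padic_abs p (inv_binomial_sum (p ^ m - k - 1))"
      using elim(2) by (intro padic_abs_diff_eq_left) simp
    moreover have "padic_abs p (of_nat (p ^ m - Suc k)) = padic_abs p (of_nat (Suc k))"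
      "padic_abs p (of_nat (p ^ m - k)) = padic_abs p (of_nat k)"
      using pm Suc.hyps by (intro padic_abs_prime_power_diff; simp)+
    ultimately have "padic_abs p (inv_binomial_sum n) = K * padic_abs p (inv_binomial_sum (p ^ m - k - 1))"
      unfolding padic_abs_inv_binomial_sum_pred[of n] n K_def by (simp only:)
    thus ?case by (simp only: n_def)
  qed
  moreover have "filterlim (\<lambda>m. K * padic_abs p (inv_binomial_sum (p ^ m - k - 1))) at_top sequentially"
    by (rule filterlim_tendsto_pos_mult_at_top[OF tendsto_const K Suc.IH])
  ultimately show ?case by (rule filterlim_at_top_mono[rotated])
qed

text \<open>Terms eventually lie within 1 of the limit, hence within 2 of each other.\<close>

lemma padic_definable_imp_bounded:
  assumes "padic_definable p f x"
  shows "\<exists>B. eventually (\<lambda>n. padic_abs p (f (padic_trunc p x n)) \<le> B) sequentially"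
proof -
  interpret Metric_space "Qp p" "padic_dist p" by (rule Metric_space_Qp[OF prime])
  let ?g = "\<lambda>n. f (padic_trunc p x n)"
  obtain L where "limitin mtopology (\<lambda>n. padic_of_rat p (?g n)) L sequentially"
    using assms unfolding padic_definable_def Qp_topology_def by blast
  hence L: "L \<in> Qp p" and ev: "\<exists>N. \<forall>n\<ge>N. padic_dist p (padic_of_rat p (?g n)) L < 1"
    unfolding limit_metric_sequentially using zero_less_one by blast+
  from ev obtain N where N: "\<And>n. n \<ge> N \<Longrightarrow> padic_dist p (padic_of_rat p (?g n)) L < 1" by blast
  have "padic_abs p (?g n) \<le> 2 + padic_abs p (?g N)" if "n \<ge> N" for n
  proof -
    have "padic_abs p (?g n - ?g N) = padic_dist p (padic_of_rat p (?g n)) (padic_of_rat p (?g N))"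
      using prime by simp
    also have "\<dots> \<le> padic_dist p (padic_of_rat p (?g n)) L + padic_dist p L (padic_of_rat p (?g N))"
      using prime L by (intro triangle) auto
    also have "\<dots> < 1 + 1"
      unfolding commute[of L "padic_of_rat p (?g N)"] by (intro add_strict_mono N that order_refl)
    finally show ?thesis
      using padic_abs_triangle[OF prime, of "?g n - ?g N" "?g N"] by simp
  qed
  thus ?thesis unfolding eventually_sequentially by blast
qed

end

lemma not_padic_definable_inv_binomial_sum:
  assumes p: "prime p" and "k > 0"
    and c: "c > 0" "\<And>m. m > 0 \<Longrightarrow> c \<le> padic_abs p (inv_binomial_sum (p ^ m - 1) - 1)"
  shows "\<not> padic_definable p inv_binomial_sum (padic_of_rat p (of_int (- int k - 1)))"
proof
  let ?x = "padic_of_rat p (of_int (- int k - 1))"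
  assume "padic_definable p inv_binomial_sum ?x"
  then obtain B where B: "eventually (\<lambda>n. padic_abs p (inv_binomial_sum (padic_trunc p ?x n)) \<le> B) sequentially"
    using padic_definable_imp_bounded[OF p] by blast
  \<comment> \<open>The truncation at \<open>n\<close> keeps the digits 0 to \<open>n\<close>, so it
    is the residue modulo \<open>p ^ Suc n\<close>.\<close>
  have "filterlim (\<lambda>n. padic_abs p (inv_binomial_sum (p ^ Suc n - k - 1))) at_top sequentially"
    using padic_abs_inv_binomial_sum_at_top[OF p c \<open>k > 0\<close>]
    by (rule filterlim_sequentially_Suc[of "\<lambda>m. padic_abs p (inv_binomial_sum (p ^ m - k - 1))", THEN iffD2])
  hence "eventually (\<lambda>n. B < padic_abs p (inv_binomial_sum (p ^ Suc n - k - 1))) sequentially"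
    by (simp only: filterlim_at_top_dense)
  moreover have "filterlim (\<lambda>n. real p ^ Suc n) at_top sequentially"
    using prime_power_at_top[OF p]
    by (rule filterlim_sequentially_Suc[of "\<lambda>m. real p ^ m", THEN iffD2])
  hence "eventually (\<lambda>n. real k < real p ^ Suc n) sequentially"
    by (simp only: filterlim_at_top_dense)
  ultimately have "eventually (\<lambda>n. False) sequentially"
    using B
  proof eventually_elim
    case (elim n)
    have k: "k < p ^ Suc n" using elim(2) by (simp only: of_nat_power[symmetric] of_nat_less_iff)
    have "(- int k - 1) mod int p ^ Suc n = (- int k - 1 + int p ^ Suc n) mod int p ^ Suc n"
      by (simp only: mod_add_self2)
    also have "- int k - 1 + int p ^ Suc n = int (p ^ Suc n - k - 1)"
      using k by (simp add: of_nat_diff del: power_Suc)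
    also have "\<dots> mod int p ^ Suc n = int (p ^ Suc n - k - 1)"
      using k by (intro mod_pos_pos_trivial) (auto simp del: power_Suc simp flip: of_nat_power)
    finally have "padic_trunc p ?x n = p ^ Suc n - k - 1"
      by (simp only: padic_trunc_of_int[OF p] nat_int)
    thus ?case using elim by simp
  qed
  thus False by simp
qed

section \<open>Wieferich primes up to 3511\<close>

text \<open>Binary exponentiation; \<open>f\<close> bounds the number of binary digits of the
  exponent and makes the recursion structural.\<close>

fun pow2_mod :: "nat \<Rightarrow> int \<Rightarrow> int \<Rightarrow> int" where
  "pow2_mod 0 e m = 1"
| "pow2_mod (Suc f) e m =
     (let t = pow2_mod f (e div 2) m in if e mod 2 = 0 then t * t mod m else 2 * t * t mod m)"

lemma pow2_mod_eq:
  assumes "m > 1" "0 \<le> e" "e < 2 ^ f"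
  shows "pow2_mod f e m = 2 ^ nat e mod m"
  using assms(2,3)
proof (induction f arbitrary: e)
  case 0
  thus ?case using assms(1) by simp
next
  case (Suc f)
  define d where "d = nat (e div 2)"
  have d: "int d = e div 2" using Suc.prems by (simp add: d_def)
  have t: "pow2_mod f (e div 2) m = 2 ^ d mod m"
    unfolding d_def using Suc.prems by (intro Suc.IH) auto
  show ?case
  proof (cases "e mod 2 = 0")
    case True
    hence "e = int (d + d)" using d by presburger
    hence "nat e = d + d" by (simp only: nat_int)
    hence "2 ^ nat e = (2 ^ d * 2 ^ d :: int)" by (simp only: power_add)
    thus ?thesis using True by (simp add: t Let_def mod_mult_eq)
  next
    case False
    hence "e = int (Suc (d + d))" using d by presburger
    hence "nat e = Suc (d + d)" by (simp only: nat_int)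
    hence "2 ^ nat e = (2 * (2 ^ d * 2 ^ d) :: int)" by (simp only: power_Suc power_add)
    moreover have "2 * (2 ^ d mod m * (2 ^ d mod m)) mod m = 2 * (2 ^ d * 2 ^ d) mod m"
      by (rule mod_mult_cong[OF refl]) (rule mod_mult_eq)
    ultimately show ?thesis using False by (simp add: t Let_def mult.assoc)
  qed
qed

text \<open>Links the natural subtraction in \<open>wieferich_prime\<close> with the integers
  measured by \<open>padic_abs\<close>.\<close>

lemma int_power_dvd_two_power_minus_one_iff:
  "int p ^ r dvd 2 ^ n - 1 \<longleftrightarrow> p ^ r dvd 2 ^ n - 1"
proof -
  have "(2 :: int) ^ n - 1 = int (2 ^ n - 1)" by (simp add: of_nat_diff)
  thus ?thesis by (simp only: of_nat_power[symmetric] int_dvd_int_iff)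
qed

lemma pow2_mod_neq_1_imp_not_dvd:
  assumes "pow2_mod f (int p - 1) (int p ^ r) \<noteq> 1" "1 < p" "p < 2 ^ f" "r > 0"
  shows "\<not> int p ^ r dvd 2 ^ (p - 1) - 1"
proof
  assume "int p ^ r dvd 2 ^ (p - 1) - 1"
  hence "2 ^ (p - 1) mod int p ^ r = 1 mod int p ^ r" by (simp only: mod_eq_dvd_iff)
  moreover have m: "int p ^ r > 1" using assms(2,4) by (intro one_less_power) auto
  moreover have "int p < 2 ^ f" using assms(3) by (metis of_nat_less_iff of_nat_numeral of_nat_power)
  hence less: "int p - 1 < 2 ^ f" by linarith
  have "pow2_mod f (int p - 1) (int p ^ r) = 2 ^ nat (int p - 1) mod int p ^ r"
    by (rule pow2_mod_eq[OF m _ less]) (use assms(2) in simp)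
  moreover have "nat (int p - 1) = p - 1" by simp
  ultimately show False using assms(1) by simp
qed

text \<open>The 12 squarings suffice because \<open>3511 < 2 ^ 12\<close>. Nested conditionals instead of a
  disjunction keep the evaluation lazy.\<close>
fun no_wieferich :: "nat \<Rightarrow> int \<Rightarrow> bool" where
  "no_wieferich 0 p = True"
| "no_wieferich (Suc n) p =
     (if p mod 3 = 0 then no_wieferich n (p + 2)
      else if p mod 5 = 0 then no_wieferich n (p + 2)
      else if p mod 7 = 0 then no_wieferich n (p + 2)
      else if pow2_mod 12 (p - 1) (p * p) = 1 then False
      else no_wieferich n (p + 2))"

lemma no_wieferich_imp_not_wieferich:
  assumes "no_wieferich n a" "i < n" "int p = a + 2 * int i" "7 < p" "p < 4096"
  shows "\<not> wieferich_prime p"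
  using assms(1-3)
proof (induction n arbitrary: a i)
  case (Suc n)
  have rest: "no_wieferich n (a + 2)" using Suc.prems(1) by (simp split: if_splits)
  show ?case
  proof (cases i)
    case (Suc j)
    show ?thesis by (rule Suc.IH[OF rest, of j]) (use Suc Suc.prems in auto)
  next
    case 0
    hence a: "a = int p" using Suc.prems(3) by simp
    show ?thesis
    proof
      assume w: "wieferich_prime p"
      hence p: "prime p" by (simp add: wieferich_prime_def)
      \<comment> \<open>A prime above 7 passes the sieve by 3, 5 and 7, so its power is really
        tested.\<close>
      have "\<not> q dvd p" if "prime q" "q < p" for q
        using primes_dvd_imp_eq[OF that(1) p] that(2) by auto
      from this[of 3] this[of 5] this[of 7] have nd: "\<not> 3 dvd p" "\<not> 5 dvd p" "\<not> 7 dvd p"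
        using assms(4) by simp_all
      have "int p mod 3 \<noteq> 0" "int p mod 5 \<noteq> 0" "int p mod 7 \<noteq> 0" using nd by presburger+
      hence "pow2_mod 12 (int p - 1) (int p * int p) \<noteq> 1"
        using Suc.prems(1) unfolding a by (simp del: pow2_mod.simps split: if_splits)
      hence "\<not> int p ^ 2 dvd 2 ^ (p - 1) - 1"
        using assms(4,5) by (intro pow2_mod_neq_1_imp_not_dvd[of 12]) (auto simp: power2_eq_square)
      thus False using w by (simp add: wieferich_prime_def int_power_dvd_two_power_minus_one_iff)
    qed
  qed
qed simp

text \<open>The blocks cover the odd numbers from 11 to 3509, with a gap only at 1093.\<close>

lemma no_wieferich_3511:
  "no_wieferich 271 11" "no_wieferich 270 553" "no_wieferich 302 1095" "no_wieferich 302 1699"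
  "no_wieferich 302 2303" "no_wieferich 302 2907"
  by code_simp+

text \<open>Excludes \<open>p ^ 3\<close> as a divisor of \<open>2 ^ (p - 1) - 1\<close> for
  \<open>p = 1093\<close> and \<open>p = 3511\<close>.\<close>

lemma pow2_mod_cubes: "pow2_mod 12 1092 (1093 ^ 3) \<noteq> 1" "pow2_mod 12 3510 (3511 ^ 3) \<noteq> 1"
  by code_simp+

lemma wieferich_prime_le_3511:
  assumes w: "wieferich_prime p" and "p \<le> 3511"
  shows "p = 1093 \<or> p = 3511"
proof (rule ccontr)
  assume ne: "\<not> (p = 1093 \<or> p = 3511)"
  have p: "prime p" using w by (simp add: wieferich_prime_def)
  have "p \<noteq> 2" "p \<noteq> 3" "p \<noteq> 5" "p \<noteq> 7"
    using w by (auto simp: wieferich_prime_def)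
  moreover have "p \<noteq> 4" "p \<noteq> 6" "p > 1" using p prime_gt_1_nat by auto
  ultimately have "p > 7" by linarith
  hence "odd p" using p by (simp add: prime_odd_nat)
  \<comment> \<open>A block of \<open>n\<close> odd numbers starting at \<open>a\<close> without
    Wieferich primes pushes \<open>p\<close> past its end.\<close>
  have step: "a + 2 * n \<le> p" if "no_wieferich n (int a)" "odd a" "a \<le> p" for n a
  proof (rule ccontr)
    assume less: "\<not> a + 2 * n \<le> p"
    have "even (p - a)" using \<open>odd p\<close> that by simp
    then obtain i where "p - a = 2 * i" by (rule evenE)
    hence "i < n" "int p = int a + 2 * int i" using less that by auto
    thus False
      using no_wieferich_imp_not_wieferich[OF that(1)] \<open>p > 7\<close> assms by simp
  qed
  have "p \<noteq> 8" "p \<noteq> 10" "p \<noteq> 1094" using \<open>odd p\<close> by auto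
  have "p \<noteq> 9" using p by auto
  with \<open>p > 7\<close> \<open>p \<noteq> 8\<close> \<open>p \<noteq> 10\<close> have "11 \<le> p" by linarith
  hence "553 \<le> p" using step[of 271 11] no_wieferich_3511 by simp
  hence "1093 \<le> p" using step[of 270 553] no_wieferich_3511 by simp
  hence "1095 \<le> p" using ne \<open>p \<noteq> 1094\<close> by linarith
  hence "1699 \<le> p" using step[of 302 1095] no_wieferich_3511 by simp
  hence "2303 \<le> p" using step[of 302 1699] no_wieferich_3511 by simp
  hence "2907 \<le> p" using step[of 302 2303] no_wieferich_3511 by simp
  hence "3511 \<le> p" using step[of 302 2907] no_wieferich_3511 by simp
  thus False using ne \<open>p \<le> 3511\<close> by simp
qed

theorem theorem1p7:
  fixes k p :: nat
  assumes "k > 0"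
    and "prime p"
    and "\<not> (wieferich_prime p \<and> p > 3511)"
  shows "\<not> padic_definable p (\<lambda>n. \<Sum>j\<le>n. inverse (of_nat (n choose j)))
             (padic_of_rat p (of_int (- int k - 1)))"
proof -
  note p = \<open>prime p\<close>
  obtain c where c: "c > 0" "\<And>m. m > 0 \<Longrightarrow> c \<le> padic_abs p (inv_binomial_sum (p ^ m - 1) - 1)"
  proof (cases "p = 2")
    case True
    show ?thesis
      by (rule that[of 1]) (use padic_abs_inv_binomial_sum_even_prime[OF p True] in auto)
  next
    case False
    hence odd: "odd p" using p primes_dvd_imp_eq[OF two_is_prime_nat p] by auto
    have nw: "\<not> int p ^ 2 dvd 2 ^ (p - 1) - 1 \<or> \<not> int p ^ 3 dvd 2 ^ (p - 1) - 1 \<and> p > 3"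
    proof (cases "wieferich_prime p")
      case True
      hence "p = 1093 \<or> p = 3511" using wieferich_prime_le_3511 assms(3) by auto
      hence "pow2_mod 12 (int p - 1) (int p ^ 3) \<noteq> 1" and p3: "3 < p" "p < 2 ^ 12"
        using pow2_mod_cubes by auto
      thus ?thesis using pow2_mod_neq_1_imp_not_dvd[of 12 p 3] by simp
    qed (use p in \<open>simp add: wieferich_prime_def int_power_dvd_two_power_minus_one_iff\<close>)
    \<comment> \<open>For odd \<open>p\<close> the bound \<open>c\<close> is the absolute value of
      \<open>2 ^ (p - 1) - 1\<close>, positive and independent of \<open>m\<close>.\<close>
    have "(1 :: rat) < 2 ^ (p - 1)"
      by (rule one_less_power) (use prime_gt_1_nat[OF p] in auto)
    hence "padic_abs p (2 ^ (p - 1) - 1) \<noteq> 0"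
      unfolding padic_abs_eq_0_iff[OF p] by linarith
    hence "padic_abs p (2 ^ (p - 1) - 1) > 0"
      using padic_abs_nonneg[of p "2 ^ (p - 1) - 1"] by linarith
    thus ?thesis
      by (rule that) (simp only: padic_abs_inv_binomial_sum_minus_one[OF p odd nw] order_refl)
  qed
  have "(\<lambda>n. \<Sum>j\<le>n. inverse (of_nat (n choose j))) = inv_binomial_sum"
    by (simp add: inv_binomial_sum_def fun_eq_iff)
  thus ?thesis using not_padic_definable_inv_binomial_sum[OF p \<open>k > 0\<close> c] by simp
qed

end
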